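(* Let $\ell,d,\rho$ be positive integers with $\ell\le m$, $d\le\ell(q-1)$ and $\rho\le|\mathbb{H}^{(\ell)}_{\le d}|$. Let $\mathcal{T}\subseteq\mathbb{H}^{(\ell)}_{\le d}$ with $|\mathcal{T}|=\rho$, and let $\rho'=|\mathcal{T}\cap\mathbb{H}^{(\ell)}_d|$. Then $$|\mathsf{FP}^{(\ell)}(\mathcal{T})|\le|\mathsf{FP}^{(\ell)}(\mathcal{U})|,\quad\text{where }\ \mathcal{U}=\mathcal{L}^{(\ell)}_d(\rho')\cup\mathcal{M}^{(\ell)}_{d-1}(\rho-\rho').$$
   Context: $q$ is a prime power and $m$ a positive integer. For $0\le\ell\le m$, $\mathbb{H}^{(\ell)}=\{x_0^{a_0}\cdots x_{\ell-1}^{a_{\ell-1}}:0\le a_j\le q-1\}$; $\mathbb{H}^{(\ell)}_d$ and $\mathbb{H}^{(\ell)}_{\le d}$ are its elements of degree $d$, resp. degree $\le d$. For $\mathcal{T}\subseteq\mathbb{H}^{(\ell)}$, the shadow is $\mathsf{SH}^{(\ell)}(\mathcal{T})=\{\mu\in\mathbb{H}^{(\ell)}:\nu\mid\mu\text{ for some }\nu\in\mathcal{T}\}$ and the footprint is $\mathsf{FP}^{(\ell)}(\mathcal{T})=\mathbb{H}^{(\ell)}\setminus\mathsf{SH}^{(\ell)}(\mathcal{T})$. Lexicographic order: $x_0^{b_0}\cdots\prec x_0^{a_0}\cdots$ iff at the first index where the exponents differ one has $a_i>b_i$. For $0\le\rho\le|\mathbb{H}^{(\ell)}_{\le d}|$,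 $\mathcal{M}^{(\ell)}_d(\rho)$ is the set of the first $\rho$ elements of $\mathbb{H}^{(\ell)}_{\le d}$ in descending lexicographic order; for $0\le\rho'\le|\mathbb{H}^{(\ell)}_d|$, $\mathcal{L}^{(\ell)}_d(\rho')$ is the set of the first $\rho'$ elements of $\mathbb{H}^{(\ell)}_d$ in descending lexicographic order. *)

theory Defs
  imports "HOL-Computational_Algebra.Primes"
begin

text \<open>Monomials x_0^a_0 ... x_(l-1)^a_(l-1) are represented by their exponent lists
  [a_0, ..., a_(l-1)].\<close>

definition H :: "nat \<Rightarrow> nat \<Rightarrow> nat list set" where
  "H q l = {a. length a = l \<and> (\<forall>i<l. a ! i \<le> q - 1)}"

definition Hd :: "nat \<Rightarrow> nat \<Rightarrow> nat \<Rightarrow> nat list set" where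
  "Hd q l d = {a \<in> H q l. sum_list a = d}"

definition Hle :: "nat \<Rightarrow> nat \<Rightarrow> nat \<Rightarrow> nat list set" where
  "Hle q l d = {a \<in> H q l. sum_list a \<le> d}"

definition mdvd :: "nat list \<Rightarrow> nat list \<Rightarrow> bool" where
  "mdvd nu mu \<longleftrightarrow> length nu = length mu \<and> (\<forall>i<length mu. nu ! i \<le> mu ! i)"

definition shadow :: "nat \<Rightarrow> nat \<Rightarrow> nat list set \<Rightarrow> nat list set" where
  "shadow q l T = {mu \<in> H q l. \<exists>nu\<in>T. mdvd nu mu}"

definition footprint :: "nat \<Rightarrow> nat \<Rightarrow> nat list set \<Rightarrow> nat list set" where
  "footprint q l T = H q l - shadow q l T"

definition lex_prec :: "nat list \<Rightarrow> nat list \<Rightarrow> bool" where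
  "lex_prec b a \<longleftrightarrow> length a = length b \<and>
     (\<exists>i<length a. (\<forall>j<i. a ! j = b ! j) \<and> b ! i < a ! i)"

text \<open>The first r elements of S in descending lexicographic order: those elements
  having fewer than r elements of S strictly above them.\<close>
definition first_lex :: "nat list set \<Rightarrow> nat \<Rightarrow> nat list set" where
  "first_lex S r = {mu \<in> S. card {nu \<in> S. lex_prec mu nu} < r}"

definition M :: "nat \<Rightarrow> nat \<Rightarrow> nat \<Rightarrow> nat \<Rightarrow> nat list set" where
  "M q l d r = first_lex (Hle q l d) r"

definition L :: "nat \<Rightarrow> nat \<Rightarrow> nat \<Rightarrow> nat \<Rightarrow> nat list set" where
  "L q l d r = first_lex (Hd q l d) r"

end

theory Submission
  imports Defs
begin

text \<open>The shadow sizes are compared degree by degree. Below degree \<open>d\<close> the set \<open>M\<close> is its own shadow.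
  In degree \<open>d\<close> the shadow of \<open>M\<close> and the set \<open>L\<close> are both lexicographic initial segments, so one
  contains the other, and it suffices to bound each of the two sizes separately. Above degree \<open>d\<close>,
  and to bound the shadow of \<open>M\<close> in degree \<open>d\<close>, one uses the Clements--Lindstroem theorem:
  among the subsets of one layer of a box, lexicographic initial segments have the smallest upper
  shadow.

  That theorem is proved by induction on the number of variables. Among all sets of the given size
  whose shadow is not larger than that of the given set, take one of least total lexicographic
  rank. By induction it is compressed in every coordinate. If it were not a segment, its last element \<open>b\<close> and the first missing element
  \<open>a\<close> would differ in every coordinate and \<open>a\<close> would be larger in the last one; replacing \<open>b\<close> by
  \<open>a\<close> then does not enlarge the shadow, a contradiction to minimality.\<close>

section \<open>Lexicographic initial segments\<close>

text \<open>Monomials become functions on all of \<open>nat\<close>, so that freezing a coordinate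
  neither changes the type nor renumbers the others. The order is still total, because two different
  functions have a least index at which they differ.\<close>

definition lexless :: "(nat \<Rightarrow> nat) \<Rightarrow> (nat \<Rightarrow> nat) \<Rightarrow> bool" where
  "lexless b a \<longleftrightarrow> (\<exists>i. (\<forall>j<i. a j = b j) \<and> b i < a i)"

lemma lexlessI: "(\<And>j. j < i \<Longrightarrow> a j = b j) \<Longrightarrow> b i < a i \<Longrightarrow> lexless b a"
  by (auto simp: lexless_def)

lemma lexless_irrefl: "\<not> lexless a a"
  by (auto simp: lexless_def)

lemma lexless_trans:
  assumes "lexless a b" "lexless b c"
  shows "lexless a c"
proof -
  from assms obtain i i' where i: "\<forall>j<i. b j = a j" "a i < b i"
    and i': "\<forall>j<i'. c j = b j" "b i' < c i'"
    by (auto simp: lexless_def)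
  consider "i < i'" | "i = i'" | "i' < i" by linarith
  then show ?thesis
  proof cases
    case 3
    with i i' show ?thesis by (intro lexlessI[of i']) auto
  qed (use i i' in \<open>auto intro!: lexlessI[of i]\<close>)
qed

lemma lexless_asym: "lexless a b \<Longrightarrow> \<not> lexless b a"
  using lexless_irrefl lexless_trans by blast

lemma lexless_linear: "a \<noteq> b \<Longrightarrow> lexless a b \<or> lexless b a"
proof -
  assume "a \<noteq> b"
  then have "\<exists>i. a i \<noteq> b i" by auto
  then obtain i where i: "a i \<noteq> b i" "\<And>j. j < i \<Longrightarrow> a j = b j"
    using exists_least_iff[of "\<lambda>i. a i \<noteq> b i"] by auto
  then show ?thesis
    using lexlessI[of i a b] lexlessI[of i b a] by (cases "a i < b i") auto
qed

lemma lexless_if_less: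
  fixes a b :: "nat \<Rightarrow> nat"
  assumes "a \<le> b" "a \<noteq> b"
  shows "lexless a b"
proof -
  have "\<not> lexless b a" using le_funD[OF assms(1)] by (auto simp: lexless_def not_less)
  then show ?thesis using lexless_linear[OF assms(2)] by blast
qed

lemma finite_lexless_max:
  assumes "finite S" "S \<noteq> {}"
  obtains x where "x \<in> S" "\<And>y. y \<in> S \<Longrightarrow> y \<noteq> x \<Longrightarrow> lexless y x"
proof -
  have "\<exists>x\<in>S. \<forall>y\<in>S. y \<noteq> x \<longrightarrow> lexless y x"
    using assms
  proof (induction S rule: finite_ne_induct)
    case (insert x F)
    then obtain m where m: "m \<in> F" "\<And>y. y \<in> F \<Longrightarrow> y \<noteq> m \<Longrightarrow> lexless y m" by blast
    then consider "lexless x m" | "lexless m x"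
      using lexless_linear insert.hyps by metis
    then show ?case
      by cases (use m lexless_trans in blast)+
  qed auto
  then show ?thesis using that by blast
qed

lemma finite_lexless_min:
  assumes "finite S" "S \<noteq> {}"
  obtains x where "x \<in> S" "\<And>y. y \<in> S \<Longrightarrow> y \<noteq> x \<Longrightarrow> lexless x y"
proof -
  have "\<exists>x\<in>S. \<forall>y\<in>S. y \<noteq> x \<longrightarrow> lexless x y"
    using assms
  proof (induction S rule: finite_ne_induct)
    case (insert x F)
    then obtain m where m: "m \<in> F" "\<And>y. y \<in> F \<Longrightarrow> y \<noteq> m \<Longrightarrow> lexless m y" by blast
    then consider "lexless x m" | "lexless m x"
      using lexless_linear insert.hyps by metis
    then show ?case
      by cases (use m lexless_trans in blast)+
  qed auto
  then show ?thesis using that by blast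
qed

definition seg :: "(nat \<Rightarrow> nat) set \<Rightarrow> (nat \<Rightarrow> nat) set \<Rightarrow> bool" where
  "seg P A \<longleftrightarrow> A \<subseteq> P \<and> (\<forall>a\<in>A. \<forall>b\<in>P. lexless a b \<longrightarrow> b \<in> A)"

lemma segD: "seg P A \<Longrightarrow> a \<in> A \<Longrightarrow> b \<in> P \<Longrightarrow> lexless a b \<Longrightarrow> b \<in> A"
  by (auto simp: seg_def)

lemma seg_subset: "seg P A \<Longrightarrow> A \<subseteq> P"
  by (auto simp: seg_def)

text \<open>A point of \<open>A - B\<close> and one of \<open>B - A\<close> are comparable, and the
  larger one would be forced into both sets. This nestedness is what lets sizes alone decide
  inclusions and unions of segments.\<close>

lemma seg_linear:
  assumes "seg P A" "seg P B"
  shows "A \<subseteq> B \<or> B \<subseteq> A"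
proof (rule ccontr)
  assume "\<not> ?thesis"
  then obtain a b where ab: "a \<in> A" "a \<notin> B" "b \<in> B" "b \<notin> A" by blast
  then have "lexless a b \<or> lexless b a" by (intro lexless_linear) auto
  then show False using ab assms by (auto simp: seg_def)
qed

lemma seg_subset_if_card_le:
  assumes "seg P A" "seg P B" "finite P" "card A \<le> card B"
  shows "A \<subseteq> B"
proof -
  have "finite A" using assms finite_subset seg_subset by blast
  then have "A = B" if "B \<subseteq> A" using card_seteq[of A B] that assms(4) by simp
  then show ?thesis using seg_linear[OF assms(1,2)] by blast
qed

lemma seg_Un: "seg P A \<Longrightarrow> seg P B \<Longrightarrow> seg P (A \<union> B)"
  by (auto simp: seg_def)

lemma card_Un_seg:
  assumes "seg P A" "seg P B"
  shows "card (A \<union> B) = card A \<or> card (A \<union> B) = card B"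
  using seg_linear[OF assms] by (auto simp: sup.absorb1 sup.absorb2)

section \<open>Ranks and initial segments of prescribed size\<close>

definition first :: "(nat \<Rightarrow> nat) set \<Rightarrow> nat \<Rightarrow> (nat \<Rightarrow> nat) set" where
  "first P t = {x \<in> P. card {y \<in> P. lexless x y} < t}"

lemma card_above_less:
  assumes "finite P" "lexless x y" "y \<in> P"
  shows "card {u \<in> P. lexless y u} < card {u \<in> P. lexless x u}"
  by (rule psubset_card_mono) (use assms lexless_irrefl lexless_trans in \<open>auto, blast\<close>)

lemma seg_first: "finite P \<Longrightarrow> seg P (first P t)"
  unfolding seg_def first_def using card_above_less by fastforce

text \<open>The number of elements above a point is injective on \<open>P\<close> by totality and
  stays below \<open>card P\<close>, so it is a bijection onto \<open>{..<card P}\<close>. Hence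
  exactly \<open>t\<close> points have fewer than \<open>t\<close> elements above them.\<close>

lemma card_first:
  assumes "finite P" "t \<le> card P"
  shows "card (first P t) = t"
proof -
  let ?f = "\<lambda>x. card {u \<in> P. lexless x u}"
  have inj: "inj_on ?f P"
    by (rule inj_onI) (use card_above_less[OF assms(1)] lexless_linear in fastforce)
  have "?f ` P \<subseteq> {..<card P}"
  proof
    fix n assume "n \<in> ?f ` P"
    then obtain x where x: "x \<in> P" "n = ?f x" by auto
    have "?f x < card P"
      by (rule psubset_card_mono) (use assms x lexless_irrefl in auto)
    then show "n \<in> {..<card P}" using x by auto
  qed
  then have im: "?f ` P = {..<card P}"
    by (rule card_subset_eq[OF finite_lessThan]) (use inj card_image in auto)
  have "?f ` first P t = {..<t}"
  proof -
    have "?f ` first P t = ?f ` P \<inter> {..<t}" by (auto simp: first_def)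
    then show ?thesis using im assms by auto
  qed
  moreover have "inj_on ?f (first P t)"
    using inj by (rule inj_on_subset) (auto simp: first_def)
  ultimately show ?thesis using card_image by fastforce
qed

text \<open>Every point of \<open>A - S\<close> lies above every point of \<open>S - A\<close>, so
  any bijection between these equally large sets raises the weight at each point. This makes the
  total weight usable as a measure of distance from a segment.\<close>

lemma sum_less_if_seg:
  fixes w :: "(nat \<Rightarrow> nat) \<Rightarrow> nat"
  assumes P: "finite P" "seg P A" "S \<subseteq> P" "card A = card S" "A \<noteq> S"
    and w: "\<And>x y. x \<in> P \<Longrightarrow> y \<in> P \<Longrightarrow> lexless x y \<Longrightarrow> w y < w x"
  shows "sum w A < sum w S"
proof -
  have fin: "finite A" "finite S" using P finite_subset seg_subset by blast+
  have c: "card (A - S) = card (S - A)"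
    using fin P(4) by (simp add: card_Diff_subset_Int Int_commute)
  have ne: "A - S \<noteq> {}"
    using P fin c by (metis Diff_eq_empty_iff card_subset_eq)
  obtain h where h: "bij_betw h (A - S) (S - A)"
    using c fin by (metis finite_Diff finite_same_card_bij)
  have "w x < w (h x)" if "x \<in> A - S" for x
  proof -
    have hx: "h x \<in> S - A" using h that by (auto simp: bij_betw_def)
    then have "lexless (h x) x"
      using that P by (metis DiffD1 DiffD2 lexless_linear segD subset_iff)
    then show ?thesis using w hx that P seg_subset by blast
  qed
  then have "sum w (A - S) < (\<Sum>x\<in>A-S. w (h x))"
    by (intro sum_strict_mono) (use fin ne in auto)
  also have "\<dots> = sum w (S - A)"
    by (rule sum.reindex_bij_betw[OF h])
  finally have "sum w (A - S) + sum w (A \<inter> S) < sum w (S - A) + sum w (A \<inter> S)" by simp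
  then show ?thesis
    using fin sum.Int_Diff[of A w S] sum.Int_Diff[of S w A] by (simp add: Int_commute add.commute)
qed

section \<open>Layers and their shadows\<close>

text \<open>Coordinates outside \<open>I\<close> are frozen to those of \<open>z\<close>, so that a coordinate slice of a layer is
  again a layer, over a smaller index set.\<close>

definition layer :: "nat \<Rightarrow> (nat \<Rightarrow> nat) \<Rightarrow> nat set \<Rightarrow> nat \<Rightarrow> (nat \<Rightarrow> nat) set" where
  "layer k z I d = {x. (\<forall>j. j \<notin> I \<longrightarrow> x j = z j) \<and> (\<forall>j\<in>I. x j \<le> k) \<and> sum x I = d}"

definition inc :: "nat \<Rightarrow> (nat \<Rightarrow> nat) \<Rightarrow> nat \<Rightarrow> nat" where
  "inc i x = x(i := Suc (x i))"

definition upper :: "nat \<Rightarrow> nat set \<Rightarrow> (nat \<Rightarrow> nat) set \<Rightarrow> (nat \<Rightarrow> nat) set" where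
  "upper k I S = {inc i x | i x. x \<in> S \<and> i \<in> I \<and> x i < k}"

lemma inc_apply: "inc i x j = (if j = i then Suc (x i) else x j)"
  by (simp add: inc_def)

lemma inj_inc: "inj (inc i)"
proof (rule injI, rule ext)
  fix x y j assume "inc i x = inc i y"
  then have "inc i x j = inc i y j" by simp
  then show "x j = y j" by (simp add: inc_apply split: if_splits)
qed

lemma upperI: "x \<in> S \<Longrightarrow> i \<in> I \<Longrightarrow> x i < k \<Longrightarrow> inc i x \<in> upper k I S"
  by (auto simp: upper_def)

lemma upper_mono: "S \<subseteq> S' \<Longrightarrow> upper k I S \<subseteq> upper k I S'"
  by (auto simp: upper_def)

lemma finite_layer: "finite I \<Longrightarrow> finite (layer k z I d)"
proof -
  assume I: "finite I"
  define F where "F = {x. \<forall>j. (j \<in> I \<longrightarrow> x j \<in> {..k}) \<and> (j \<notin> I \<longrightarrow> x j = (0::nat))}"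
  have "finite F"
    unfolding F_def by (rule finite_set_of_finite_funs[OF I]) simp
  then have "finite ((\<lambda>x j. if j \<in> I then x j else z j) ` F)" by (rule finite_imageI)
  then show ?thesis
  proof (rule rev_finite_subset, intro subsetI)
    fix x assume x: "x \<in> layer k z I d"
    show "x \<in> (\<lambda>x j. if j \<in> I then x j else z j) ` F"
      by (rule image_eqI[of _ _ "\<lambda>j. if j \<in> I then x j else 0"])
        (use x in \<open>auto simp: layer_def F_def\<close>)
  qed
qed

lemma sum_upd:
  fixes x :: "nat \<Rightarrow> nat"
  assumes "finite I" "i \<in> I"
  shows "sum (x(i := c)) I + x i = sum x I + c"
  using assms by (simp add: sum.remove)

lemma inc_layer_iff:
  assumes "finite I" "i \<in> I" "x i < k"
  shows "inc i x \<in> layer k z I (Suc d) \<longleftrightarrow> x \<in> layer k z I d"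
proof -
  have "sum (inc i x) I = Suc (sum x I)"
    using sum_upd[OF assms(1,2), of x "Suc (x i)"] by (simp add: inc_def)
  then show ?thesis using assms by (auto simp: layer_def inc_apply)
qed

lemma upper_subset_layer:
  assumes "finite I" "S \<subseteq> layer k z I d"
  shows "upper k I S \<subseteq> layer k z I (Suc d)"
  using assms by (auto simp: upper_def inc_layer_iff)

lemma finite_upper:
  assumes "finite I" "S \<subseteq> layer k z I d"
  shows "finite (upper k I S)"
  using upper_subset_layer[OF assms] finite_layer[OF assms(1)] finite_subset by blast

text \<open>Lowering the last nonzero coordinate of \<open>c\<close> keeps it lexicographically above \<open>a\<close>: if the
  decrement hits the coordinate that decides \<open>lexless a c\<close>, the degree bound leaves no room for
  \<open>a\<close> beyond that coordinate.\<close>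

lemma lexless_predecessor:
  assumes I: "finite I" and c: "c \<in> layer k z I (Suc d)" and a: "a \<in> layer k z I e" "e \<le> d"
    and less: "lexless a c"
  obtains c' j where "c' \<in> layer k z I d" "j \<in> I" "c' j < k" "c = inc j c'" "c' = a \<or> lexless a c'"
proof -
  from less obtain p where p: "\<forall>j<p. c j = a j" "a p < c p"
    by (auto simp: lexless_def)
  have out: "a j = c j" if "j \<notin> I" for j using that a c by (auto simp: layer_def)
  then have pI: "p \<in> I" using p by force
  define j where "j = Max {i \<in> I. c i > 0}"
  have fin: "finite {i \<in> I. c i > 0}" using I by simp
  have pin: "p \<in> {i \<in> I. c i > 0}" using pI p by auto
  have j: "j \<in> I" "c j > 0" using Max_in[OF fin] pin unfolding j_def by auto
  have pj: "p \<le> j" unfolding j_def using fin pin by (rule Max_ge)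
  have after: "c i = 0" if "i \<in> I" "i > j" for i
    using Max_ge[OF fin, of i] that unfolding j_def by force
  define c' where "c' = c(j := c j - 1)"
  have cc': "c = inc j c'" using j by (auto simp: c'_def inc_def)
  have ck: "c' j < k" using c j by (auto simp: c'_def layer_def)
  have c'l: "c' \<in> layer k z I d" using inc_layer_iff[of I j c' k z d] I j ck c cc' by simp
  have "c' = a \<or> lexless a c'"
  proof (cases "p < j \<or> a p < c p - 1")
    case True
    have "lexless a c'"
      by (rule lexlessI[of p]) (use p pj True in \<open>auto simp: c'_def\<close>)
    then show ?thesis ..
  next
    case False
    then have jp: "j = p" and cp: "c p - 1 = a p" using p pj by auto
    have eq: "c' i = a i" if "i \<le> p" for i using that p cp by (auto simp: c'_def jp)
    \<comment> \<open>Beyond \<open>p\<close> the point \<open>c'\<close> vanishes, so it is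
      pointwise at most \<open>a\<close>. A strict inequality somewhere would give
      \<open>d = sum c' I < sum a I = e\<close>, against \<open>e \<le> d\<close>.\<close>
    have le: "c' i \<le> a i" for i
      using eq[of i] after[of i] out[of i] j(1) by (cases "i \<le> p"; cases "i \<in> I") (auto simp: c'_def jp)
    have "c' i = a i" if "i \<in> I" for i
    proof (rule ccontr)
      assume "c' i \<noteq> a i"
      then have "c' i < a i" using le[of i] by simp
      then have "sum c' I < sum a I"
        using le that by (intro sum_strict_mono_ex1) (use I in auto)
      then show False using a c'l by (auto simp: layer_def)
    qed
    then have "c' = a" using out j(1) by (intro ext) (metis c'_def fun_upd_apply)
    then show ?thesis ..
  qed
  then show ?thesis using that c'l j(1) ck cc' by blast
qed

lemma lexless_inc: "lexless x (inc i x)"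
  by (rule lexlessI[of i]) (auto simp: inc_apply)

text \<open>A point \<open>c\<close> above \<open>inc i a\<close> is also above \<open>a\<close>.
  Some predecessor of \<open>c\<close> is then \<open>a\<close> itself or above \<open>a\<close>,
  hence in \<open>A\<close>, and it has \<open>c\<close> in its shadow.\<close>

lemma seg_upper:
  assumes I: "finite I" and A: "seg (layer k z I d) A"
  shows "seg (layer k z I (Suc d)) (upper k I A)"
  unfolding seg_def
proof (intro conjI ballI impI)
  show "upper k I A \<subseteq> layer k z I (Suc d)" using upper_subset_layer I A seg_subset by blast
next
  fix y c assume y: "y \<in> upper k I A" and c: "c \<in> layer k z I (Suc d)" and less: "lexless y c"
  from y obtain i a where a: "a \<in> A" "y = inc i a" by (auto simp: upper_def)
  then have "lexless a c" using lexless_inc lexless_trans less by blast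
  moreover have "a \<in> layer k z I d" using a A seg_subset by blast
  ultimately obtain c' j where c': "c' \<in> layer k z I d" "j \<in> I" "c' j < k" "c = inc j c'" "c' = a \<or> lexless a c'"
    using lexless_predecessor[OF I c, of a d] by blast
  then have "c' \<in> A" using a A segD by blast
  then show "c \<in> upper k I A" using c' upperI by blast
qed

section \<open>Compression\<close>

text \<open>The claim for one index set and one bound \<open>k\<close>. Quantifying over
  \<open>z\<close> and \<open>d\<close> inside makes the induction hypothesis for
  \<open>I - {i}\<close> available for all slices at once, whatever their frozen value and
  degree.\<close>

definition CL :: "nat \<Rightarrow> nat set \<Rightarrow> bool" where
  "CL k I \<longleftrightarrow> (\<forall>z d S A. S \<subseteq> layer k z I d \<longrightarrow> seg (layer k z I d) A \<longrightarrow> card A \<le> card S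
     \<longrightarrow> card (upper k I A) \<le> card (upper k I S))"

lemma CLD:
  "CL k I \<Longrightarrow> S \<subseteq> layer k z I d \<Longrightarrow> seg (layer k z I d) A \<Longrightarrow> card A \<le> card S
    \<Longrightarrow> card (upper k I A) \<le> card (upper k I S)"
  by (simp add: CL_def)

lemma slice_layer:
  assumes "finite I" "i \<in> I" "c \<le> k" "c \<le> d"
  shows "{x \<in> layer k z I d. x i = c} = layer k (z(i := c)) (I - {i}) (d - c)"
  using assms by (auto simp: layer_def sum.remove[of I i])

lemma slice_layer_empty:
  assumes "finite I" "i \<in> I" "d < c"
  shows "{x \<in> layer k z I d. x i = c} = {}"
  using assms by (auto simp: layer_def sum.remove[of I i])

text \<open>A shadow point in slice \<open>c\<close> was raised either in another coordinate, inside
  the slice, or in coordinate \<open>i\<close>, from the slice below. Writing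
  \<open>Suc (x i) = c\<close> leaves the second part empty when \<open>c = 0\<close>.\<close>

lemma slice_upper:
  assumes "i \<in> I"
  shows "{y \<in> upper k I S. y i = c} =
    upper k (I - {i}) {x \<in> S. x i = c} \<union> inc i ` {x \<in> S. x i < k \<and> Suc (x i) = c}"
proof (intro equalityI subsetI)
  fix y assume "y \<in> {y \<in> upper k I S. y i = c}"
  then obtain j x where "x \<in> S" "j \<in> I" "x j < k" "y = inc j x" "y i = c"
    by (auto simp: upper_def)
  then show "y \<in> upper k (I - {i}) {x \<in> S. x i = c} \<union> inc i ` {x \<in> S. x i < k \<and> Suc (x i) = c}"
    by (cases "j = i") (auto simp: inc_apply intro!: upperI)
next
  fix y assume "y \<in> upper k (I - {i}) {x \<in> S. x i = c} \<union> inc i ` {x \<in> S. x i < k \<and> Suc (x i) = c}"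
  then show "y \<in> {y \<in> upper k I S. y i = c}"
    using assms by (auto simp: upper_def inc_apply)
qed

lemma seg_slice_upper:
  assumes I: "finite I" "i \<in> I" and c: "c \<le> k" and A: "seg {x \<in> layer k z I d. x i = c} A"
  shows "seg {x \<in> layer k z I (Suc d). x i = c} (upper k (I - {i}) A)"
proof (cases "c \<le> d")
  case True
  then have "seg (layer k (z(i := c)) (I - {i}) (d - c)) A"
    using A slice_layer[OF I c] by simp
  then have "seg (layer k (z(i := c)) (I - {i}) (Suc (d - c))) (upper k (I - {i}) A)"
    using I by (intro seg_upper) auto
  then show ?thesis using slice_layer[OF I c, of "Suc d"] True by (simp add: Suc_diff_le)
next
  case False
  then have "A = {}" using slice_layer_empty[OF I, of d c] seg_subset[OF A] by auto
  then show ?thesis by (auto simp: upper_def seg_def)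
qed

text \<open>Points of one slice agree at \<open>i\<close>, so their first difference lies elsewhere
  and shifting coordinate \<open>i\<close> preserves their order.\<close>

lemma seg_slice_inc:
  assumes I: "finite I" "i \<in> I" and c: "c < k" and A: "seg {x \<in> layer k z I d. x i = c} A"
  shows "seg {x \<in> layer k z I (Suc d). x i = Suc c} (inc i ` A)"
  unfolding seg_def
proof (intro conjI ballI impI)
  show "inc i ` A \<subseteq> {x \<in> layer k z I (Suc d). x i = Suc c}"
    using seg_subset[OF A] I c inc_layer_iff by (auto simp: inc_apply)
next
  fix y y' assume y: "y \<in> inc i ` A" and y': "y' \<in> {x \<in> layer k z I (Suc d). x i = Suc c}"
    and less: "lexless y y'"
  obtain x where x: "x \<in> A" "y = inc i x" using y by auto
  have xc: "x i = c" using x seg_subset[OF A] by auto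
  define x' where "x' = y'(i := c)"
  have y'_eq: "y' = inc i x'" using y' by (auto simp: x'_def inc_def)
  have x': "x' \<in> {x \<in> layer k z I d. x i = c}"
    using inc_layer_iff[of I i x' k z d] I c y' by (auto simp: y'_eq[symmetric]) (auto simp: x'_def)
  obtain m where m: "\<forall>j<m. y' j = y j" "y m < y' m" using less by (auto simp: lexless_def)
  have "m \<noteq> i" using m y' xc x(2) by (auto simp: inc_apply)
  then have "lexless x x'"
    using m xc by (intro lexlessI[of m]) (auto simp: x'_def x(2) inc_apply split: if_splits)
  then have "x' \<in> A" using segD[OF A x(1) x'] by simp
  then show "y' \<in> inc i ` A" using y'_eq by auto
qed

section \<open>Replacing every slice by a segment of the same size\<close>

lemma sum_slices:
  fixes w :: "(nat \<Rightarrow> nat) \<Rightarrow> nat"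
  assumes "finite X" "\<And>x. x \<in> X \<Longrightarrow> x i \<le> k"
  shows "(\<Sum>c\<le>k. sum w {x \<in> X. x i = c}) = sum w X"
  using sum.group[of X "{..k}" "\<lambda>x. x i" w] assms by auto

lemma card_slices:
  fixes X :: "(nat \<Rightarrow> nat) set"
  assumes "finite X" "\<And>x. x \<in> X \<Longrightarrow> x i \<le> k"
  shows "(\<Sum>c\<le>k. card {x \<in> X. x i = c}) = card X"
  using sum_slices[of X i k "\<lambda>_. 1"] assms by simp

definition compress :: "nat \<Rightarrow> (nat \<Rightarrow> nat) set \<Rightarrow> (nat \<Rightarrow> nat) set \<Rightarrow> (nat \<Rightarrow> nat) set" where
  "compress i P S = (\<Union>c. first {x \<in> P. x i = c} (card {x \<in> S. x i = c}))"

lemma slice_compress: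
  "{x \<in> compress i P S. x i = c} = first {x \<in> P. x i = c} (card {x \<in> S. x i = c})"
  by (auto simp: compress_def first_def)

lemma compress_subset: "compress i P S \<subseteq> P"
  by (auto simp: compress_def first_def)

lemma seg_slice_compress:
  assumes "finite P"
  shows "seg {x \<in> P. x i = c} {x \<in> compress i P S. x i = c}"
  unfolding slice_compress using assms by (intro seg_first) simp

lemma card_slice_compress:
  assumes "finite P" "S \<subseteq> P"
  shows "card {x \<in> compress i P S. x i = c} = card {x \<in> S. x i = c}"
  unfolding slice_compress
  by (rule card_first) (use assms in \<open>auto intro!: card_mono\<close>)

lemma card_compress:
  assumes I: "finite I" "i \<in> I" and S: "S \<subseteq> layer k z I d"
  shows "card (compress i (layer k z I d) S) = card S"
proof -
  have fin: "finite (layer k z I d)" using I finite_layer by blast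
  have "x i \<le> k" if "x \<in> layer k z I d" for x using that I by (auto simp: layer_def)
  then have "x i \<le> k" if "x \<in> S \<or> x \<in> compress i (layer k z I d) S" for x
    using that S compress_subset by blast
  then show ?thesis
    using card_slices[of S i k] card_slices[of "compress i (layer k z I d) S" i k]
      card_slice_compress[OF fin S] finite_subset[OF S fin] finite_subset[OF compress_subset fin]
    by simp
qed

text \<open>Each slice of the shadow is the union of the shadow of a slice and a shifted slice. After
  compression these two are nested, so the size of their union is the larger of the two sizes.\<close>

lemma card_upper_compress:
  assumes I: "finite I" "i \<in> I" and S: "S \<subseteq> layer k z I d" and IH: "CL k (I - {i})"
  shows "card (upper k I (compress i (layer k z I d) S)) \<le> card (upper k I S)"
proof -
  define P where "P = layer k z I d"
  define C where "C = compress i P S"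
  have fin: "finite P" unfolding P_def using I finite_layer by blast
  have SP: "S \<subseteq> P" and CP: "C \<subseteq> P" using S compress_subset by (auto simp: P_def C_def)
  have le: "y i \<le> k" if "X \<subseteq> P" "y \<in> upper k I X" for X y
    using upper_subset_layer[OF I(1), of X k z d] that I by (auto simp: P_def layer_def)
  have finU: "finite (upper k I X)" if "X \<subseteq> P" for X
    using finite_upper I that P_def by blast
  have slice: "card {y \<in> upper k I C. y i = c} \<le> card {y \<in> upper k I S. y i = c}" if c: "c \<le> k" for c
  proof -
    let ?A = "\<lambda>X. upper k (I - {i}) {x \<in> X. x i = c}"
    let ?B = "\<lambda>X. inc i ` {x \<in> X. x i < k \<and> Suc (x i) = c}"
    have finS: "finite {y \<in> upper k I S. y i = c}" using finU SP by simp
    have eq: "{y \<in> upper k I X. y i = c} = ?A X \<union> ?B X" for X by (rule slice_upper[OF I(2)])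
    have A: "card (?A C) \<le> card (?A S)"
    proof (cases "c \<le> d")
      case True
      have sl: "{x \<in> P. x i = c} = layer k (z(i := c)) (I - {i}) (d - c)"
        unfolding P_def using slice_layer I c True by blast
      show ?thesis
      proof (rule CLD[OF IH])
        show "{x \<in> S. x i = c} \<subseteq> layer k (z(i := c)) (I - {i}) (d - c)"
          unfolding sl[symmetric] using SP by auto
        show "seg (layer k (z(i := c)) (I - {i}) (d - c)) {x \<in> C. x i = c}"
          unfolding sl[symmetric] C_def by (rule seg_slice_compress[OF fin])
      qed (simp add: C_def card_slice_compress[OF fin SP])
    next
      case False
      then have "{x \<in> C. x i = c} = {}" using slice_layer_empty[OF I, of d c k z] CP P_def by auto
      then have "?A C = {}" by (simp only: upper_def) simp
      then show ?thesis by simp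
    qed
    have B: "card (?B C) = card (?B S)"
    proof (cases c)
      case (Suc c')
      then have "{x \<in> X. x i < k \<and> Suc (x i) = c} = {x \<in> X. x i = c'}" for X using c by auto
      then show ?thesis
        by (simp add: card_image[OF inj_on_subset[OF inj_inc]] C_def card_slice_compress[OF fin SP])
    qed simp
    have segA: "seg {x \<in> layer k z I (Suc d). x i = c} (?A C)"
      by (rule seg_slice_upper[OF I c]) (use seg_slice_compress[OF fin] in \<open>simp add: C_def P_def\<close>)
    have segB: "seg {x \<in> layer k z I (Suc d). x i = c} (?B C)"
    proof (cases c)
      case (Suc c')
      then have eq: "{x \<in> C. x i < k \<and> Suc (x i) = c} = {x \<in> C. x i = c'}" using c by auto
      show ?thesis
        unfolding eq unfolding Suc
        by (rule seg_slice_inc[OF I]) (use Suc c seg_slice_compress[OF fin] in \<open>auto simp: C_def P_def\<close>)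
    qed (simp add: seg_def)
    have "card (?A S) \<le> card (?A S \<union> ?B S)" "card (?B S) \<le> card (?A S \<union> ?B S)"
      using finS unfolding eq by (auto intro!: card_mono)
    moreover have "card (?A C \<union> ?B C) = card (?A C) \<or> card (?A C \<union> ?B C) = card (?B C)"
      by (rule card_Un_seg[OF segA segB])
    ultimately show ?thesis unfolding eq using A B by linarith
  qed
  have "card (upper k I C) = (\<Sum>c\<le>k. card {y \<in> upper k I C. y i = c})"
    by (rule card_slices[symmetric]) (use finU CP le in auto)
  also have "\<dots> \<le> (\<Sum>c\<le>k. card {y \<in> upper k I S. y i = c})"
    by (rule sum_mono) (use slice in auto)
  also have "\<dots> = card (upper k I S)"
    by (rule card_slices) (use finU SP le in auto)
  finally show ?thesis by (simp add: C_def P_def)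
qed

text \<open>Apply \<open>sum_less_if_seg\<close> slice by slice: no slice gains weight, and a slice
  that changes loses some. A set of minimal weight is therefore fixed by compression.\<close>

lemma sum_compress_less:
  fixes w :: "(nat \<Rightarrow> nat) \<Rightarrow> nat"
  assumes I: "finite I" "i \<in> I" and S: "S \<subseteq> layer k z I d"
    and w: "\<And>x y. x \<in> layer k z I d \<Longrightarrow> y \<in> layer k z I d \<Longrightarrow> lexless x y \<Longrightarrow> w y < w x"
    and ne: "compress i (layer k z I d) S \<noteq> S"
  shows "sum w (compress i (layer k z I d) S) < sum w S"
proof -
  define P where "P = layer k z I d"
  define C where "C = compress i P S"
  have fin: "finite P" unfolding P_def using I finite_layer by blast
  have SP: "S \<subseteq> P" and CP: "C \<subseteq> P" using S compress_subset by (auto simp: P_def C_def)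
  have le: "x i \<le> k" if "x \<in> P" for x using that I by (auto simp: P_def layer_def)
  have less: "sum w {x \<in> C. x i = c} < sum w {x \<in> S. x i = c}"
    if "{x \<in> C. x i = c} \<noteq> {x \<in> S. x i = c}" for c
    by (rule sum_less_if_seg[of "{x \<in> P. x i = c}"])
      (use fin SP seg_slice_compress[OF fin] card_slice_compress[OF fin SP] that w
        in \<open>auto simp: C_def P_def\<close>)
  have mono: "sum w {x \<in> C. x i = c} \<le> sum w {x \<in> S. x i = c}" for c
    using less[of c] by (cases "{x \<in> C. x i = c} = {x \<in> S. x i = c}") auto
  obtain x where x: "x \<in> P" "(x \<in> C) \<noteq> (x \<in> S)" using ne SP CP by (auto simp: C_def P_def)
  then have "{y \<in> C. y i = x i} \<noteq> {y \<in> S. y i = x i}" by blast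
  then have "sum w {y \<in> C. y i = x i} < sum w {y \<in> S. y i = x i}" by (rule less)
  then have "(\<Sum>c\<le>k. sum w {x \<in> C. x i = c}) < (\<Sum>c\<le>k. sum w {x \<in> S. x i = c})"
    using mono le[OF x(1)] by (intro sum_strict_mono_ex1) auto
  moreover have "(\<Sum>c\<le>k. sum w {x \<in> C. x i = c}) = sum w C"
    by (rule sum_slices) (use fin CP finite_subset le in blast)+
  moreover have "(\<Sum>c\<le>k. sum w {x \<in> S. x i = c}) = sum w S"
    by (rule sum_slices) (use fin SP finite_subset le in blast)+
  ultimately show ?thesis by (simp add: C_def P_def)
qed

section \<open>The Clements--Lindstroem theorem\<close>

text \<open>With at most one free coordinate the prescribed sum determines the point, so a layer has
  at most one element.\<close>

lemma CL_card_le_1: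
  assumes "finite I" "card I \<le> 1"
  shows "CL k I"
  unfolding CL_def
proof (intro allI impI)
  fix z d S A
  assume S: "S \<subseteq> layer k z I d" and A: "seg (layer k z I d) A" and le: "card A \<le> card S"
  have eq: "x = y" if "x \<in> layer k z I d" "y \<in> layer k z I d" for x y
  proof
    fix j
    have "I = {} \<or> (\<exists>i. I = {i})"
      using assms by (cases "card I = 0") (auto simp: card_1_singleton_iff le_Suc_eq)
    then show "x j = y j" using that by (cases "j \<in> I") (auto simp: layer_def)
  qed
  have fin: "finite (layer k z I d)" using finite_layer assms by blast
  have "A \<subseteq> S"
  proof (cases "A = {}")
    case False
    then have "card A > 0" using fin A by (metis card_gt_0_iff finite_subset seg_subset)
    then obtain x where "x \<in> S" using le by fastforce
    then show ?thesis using eq S seg_subset[OF A] by blast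
  qed simp
  then show "card (upper k I A) \<le> card (upper k I S)"
    by (intro card_mono upper_mono finite_upper[OF assms(1) S])
qed

text \<open>A layer is a chain in which \<open>x p\<close> grows as \<open>x r\<close> shrinks.
  Raising \<open>p\<close> in a point is the same as raising \<open>r\<close> in the next higher
  one, so the shadow of a segment is little more than a shifted copy of it. The count depends on
  whether \<open>d < k\<close>.\<close>

lemma CL_pair:
  assumes pr: "p < r"
  shows "CL k {p, r}"
  unfolding CL_def
proof (intro allI impI)
  fix z d S A
  assume S: "S \<subseteq> layer k z {p, r} d" and A: "seg (layer k z {p, r} d) A" and le: "card A \<le> card S"
  define P where "P = layer k z {p, r} d"
  have finP: "finite P" unfolding P_def by (rule finite_layer) simp
  have finS: "finite S" and finA: "finite A"
    using finP S seg_subset[OF A] finite_subset P_def by blast+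
  have P_iff: "x \<in> P \<longleftrightarrow> (\<forall>j. j \<noteq> p \<and> j \<noteq> r \<longrightarrow> x j = z j) \<and> x p \<le> k \<and> x r \<le> k \<and> x p + x r = d" for x
    using pr by (auto simp: P_def layer_def)
  have P_less: "lexless x y" if "x \<in> P" "y \<in> P" "x p < y p" for x y
    using that pr by (intro lexlessI[of p]) (auto simp: P_iff)
  have P_eq: "x = y" if "x \<in> P" "y \<in> P" "x r = y r" for x y
    using that by (intro ext) (metis P_iff add_right_cancel)
  \<comment> \<open>\<open>R X\<close> is the shifted copy: raising \<open>r\<close> is injective
    and loses only the point with \<open>x r = k\<close>.\<close>
  define R where "R = (\<lambda>X. inc r ` {x \<in> X. x r < k})"
  have R_sub: "R X \<subseteq> upper k {p, r} X" for X by (auto simp: R_def intro: upperI)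
  have R_card: "card (R X) = card {x \<in> X. x r < k}" for X
    unfolding R_def by (rule card_image) (rule inj_on_subset[OF inj_inc], simp)
  have finU: "finite (upper k {p, r} S)" by (rule finite_upper[OF _ S]) simp
  \<comment> \<open>The one point that may fall outside \<open>R A\<close> comes from raising
    \<open>p\<close> where \<open>a r = 0\<close>, at the top of the chain. It exists only if
    \<open>d < k\<close>.\<close>
  have U: "y \<in> R A \<or> d < k \<and> y = z(p := Suc d, r := 0)" if "y \<in> upper k {p, r} A" for y
  proof -
    obtain i a where a: "a \<in> A" "i = p \<or> i = r" "a i < k" "y = inc i a"
      using \<open>y \<in> _\<close> by (auto simp: upper_def)
    have aP: "a \<in> P" using a A seg_subset P_def by blast
    show ?thesis
    proof (cases "i = r")
      case True
      then show ?thesis using a by (auto simp: R_def)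
    next
      case False
      then have i: "i = p" using a by simp
      show ?thesis
      proof (cases "a r = 0")
        case True
        have "y = z(p := Suc d, r := 0)"
          using aP True pr by (intro ext) (auto simp: P_iff a(4) i inc_apply)
        then show ?thesis using True aP a(3) i by (auto simp: P_iff)
      next
        case False
        define a' where "a' = (inc p a)(r := a r - 1)"
        have a': "a' \<in> P" using aP False pr a(3) i by (auto simp: P_iff a'_def inc_apply)
        moreover have "lexless a a'" using aP a' pr by (intro P_less) (auto simp: a'_def inc_apply)
        ultimately have "a' \<in> A" using segD[OF A a(1)] by (simp add: P_def)
        moreover have "a' r < k" using aP False by (auto simp: a'_def P_iff)
        moreover have "y = inc r a'"
          using pr False by (intro ext) (auto simp: a(4) i a'_def inc_apply)
        ultimately show ?thesis by (auto simp: R_def)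
      qed
    qed
  qed
  have RA: "finite (R A)" "card (R A) \<le> card A"
    using finA by (auto simp: R_def) (auto simp: R_card[unfolded R_def] intro!: card_mono)
  show "card (upper k {p, r} A) \<le> card (upper k {p, r} S)"
  proof (cases "A \<subseteq> S")
    case True
    then show ?thesis by (intro card_mono upper_mono finU)
  next
    case False
    then obtain x0 where x0: "x0 \<in> A" "x0 \<notin> S" by blast
    show ?thesis
    proof (cases "d < k")
      case True
      have "upper k {p, r} A \<subseteq> insert (z(p := Suc d, r := 0)) (R A)" using U by blast
      then have "card (upper k {p, r} A) \<le> card (insert (z(p := Suc d, r := 0)) (R A))"
        using RA by (intro card_mono) auto
      also have "\<dots> \<le> Suc (card A)" using RA by (simp add: card_insert_if)
      also have "\<dots> \<le> Suc (card S)" using le by simp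
      also have "\<dots> \<le> card (upper k {p, r} S)"
      proof -
        have "card A > 0" using x0 finA card_gt_0_iff by blast
        then have "S \<noteq> {}" using le by auto
        then obtain m where m: "m \<in> S" "\<And>y. y \<in> S \<Longrightarrow> y \<noteq> m \<Longrightarrow> lexless y m"
          using finite_lexless_max finS by blast
        have lk: "x p < k" "x r < k" if "x \<in> S" for x
          using that S True by (auto simp: P_def[symmetric] P_iff)
        \<comment> \<open>Any nonempty \<open>S\<close> also gains a point beyond its shifted copy:
          \<open>inc p m\<close> could only be \<open>inc r x\<close> for an \<open>x\<close> above
          the largest element \<open>m\<close>.\<close>
        have "inc p m \<notin> R S"
        proof
          assume "inc p m \<in> R S"
          then obtain x where x: "x \<in> S" "inc p m = inc r x" by (auto simp: R_def)
          then have "inc p m p = inc r x p" by simp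
          then have mx: "m p < x p" using pr by (simp add: inc_apply)
          then have "lexless m x" using P_less m x S by (auto simp: P_def)
          moreover have "lexless x m" using m(2)[OF x(1)] mx by blast
          ultimately show False using lexless_asym by blast
        qed
        moreover have "inc p m \<in> upper k {p, r} S" using m lk by (intro upperI) auto
        moreover have "card (R S) = card S"
          unfolding R_card using lk by (intro arg_cong[where f = card]) auto
        moreover have "finite (R S)" using finU R_sub finite_subset by blast
        ultimately show ?thesis
          using card_mono[OF finU, of "insert (inc p m) (R S)"] R_sub[of S] by simp
      qed
      finally show ?thesis .
    next
      case dk: False
      have "upper k {p, r} A \<subseteq> R A" using U dk by blast
      then have "card (upper k {p, r} A) \<le> card S"
        using RA le by (meson card_mono le_trans)
      also have "\<dots> \<le> card (upper k {p, r} S)"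
      proof (cases "\<exists>y\<in>S. y r = k")
        case False
        then have "x r < k" if "x \<in> S" for x
          using that S by (metis P_def P_iff le_neq_implies_less subset_iff)
        then have "{x \<in> S. x r < k} = S" by auto
        then show ?thesis using card_mono[OF finU R_sub] R_card[of S] by simp
      next
        case True
        then obtain y0 where y0: "y0 \<in> S" "y0 r = k" by blast
        \<comment> \<open>Here \<open>R S\<close> misses the contribution of \<open>y0\<close>. The
          least gap \<open>x\<close> of \<open>S\<close> makes up for it: its lower neighbour
          \<open>y\<close> is in \<open>S\<close>, and \<open>inc p y = inc r x\<close> is a shadow
          point outside \<open>R S\<close>.\<close>
        have "finite (P - S)" "P - S \<noteq> {}" using finP x0 seg_subset[OF A] by (auto simp: P_def)
        then obtain x where x: "x \<in> P - S" "\<And>y. y \<in> P - S \<Longrightarrow> y \<noteq> x \<Longrightarrow> lexless x y"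
          using finite_lexless_min by blast
        have "x r \<noteq> k" using P_eq[of x y0] y0 x(1) S by (auto simp: P_def)
        then have xr: "x r < k" "x p > 0" using x(1) dk by (auto simp: P_iff)
        define y where "y = (inc r x)(p := x p - 1)"
        have y: "y \<in> P" using x(1) xr pr by (auto simp: P_iff y_def inc_apply)
        have yp: "y p < x p" using xr by (simp add: y_def)
        then have "lexless y x" using P_less y x(1) by blast
        then have "\<not> lexless x y" by (rule lexless_asym)
        then have "y \<in> S" using x(2)[of y] y yp by blast
        moreover have xy: "inc r x = inc p y"
          using xr pr by (intro ext) (auto simp: y_def inc_apply)
        moreover have "y p < k" using yp x(1) by (auto simp: P_iff)
        ultimately have new: "inc r x \<in> upper k {p, r} S" unfolding xy by (intro upperI) auto
        have "inc r x \<notin> R S" using x(1) injD[OF inj_inc] by (auto simp: R_def)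
        moreover have finR: "finite (R S)" using finU R_sub finite_subset by blast
        ultimately have "Suc (card (R S)) \<le> card (upper k {p, r} S)"
          using card_mono[OF finU, of "insert (inc r x) (R S)"] R_sub[of S] new by simp
        moreover have "card S \<le> Suc (card (R S))"
        proof -
          have "S \<subseteq> insert y0 {x \<in> S. x r < k}"
          proof
            fix u assume u: "u \<in> S"
            then have "u r \<le> k" using S by (auto simp: P_def[symmetric] P_iff)
            then show "u \<in> insert y0 {x \<in> S. x r < k}"
              using u P_eq[of u y0] y0 S by (cases "u r = k") (auto simp: P_def)
          qed
          then have "card S \<le> card (insert y0 {x \<in> S. x r < k})"
            using finS by (intro card_mono) auto
          also have "\<dots> \<le> Suc (card {x \<in> S. x r < k})" using finS by (simp add: card_insert_if)
          finally show ?thesis by (simp add: R_card)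
        qed
        ultimately show ?thesis by simp
      qed
      finally show ?thesis .
    qed
  qed
qed

section \<open>Exchange argument for three or more coordinates\<close>

lemma sum_upd2:
  fixes x :: "nat \<Rightarrow> nat"
  assumes "finite I" "i \<in> I" "j \<in> I" "i \<noteq> j"
  shows "sum (x(i := u, j := v)) I + x i + x j = sum x I + u + v"
  using sum_upd[OF assms(1,3), of "x(i := u)" v] sum_upd[OF assms(1,2), of x u] assms(4) by simp

text \<open>If \<open>a\<close> did not exceed \<open>b\<close> in the last coordinate, moving weight between two coordinates of
  \<open>a\<close> or of \<open>b\<close> would give a point strictly between them that shares a coordinate with each.\<close>

lemma last_coordinate_less:
  assumes I: "finite I" "3 \<le> card I" and a: "a \<in> layer k z I d" and b: "b \<in> layer k z I d"
    and less: "lexless b a" and ne: "\<And>i. i \<in> I \<Longrightarrow> a i \<noteq> b i"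
    and no: "\<And>c i j. c \<in> layer k z I d \<Longrightarrow> lexless b c \<Longrightarrow> lexless c a \<Longrightarrow> i \<in> I \<Longrightarrow> j \<in> I
      \<Longrightarrow> c i = a i \<Longrightarrow> c j = b j \<Longrightarrow> False"
  shows "b (Max I) < a (Max I)"
proof (rule ccontr)
  define p r where "p = Min I" and "r = Max I"
  assume neg: "\<not> b (Max I) < a (Max I)"
  have Ine: "I \<noteq> {}" using I by auto
  have p: "p \<in> I" "\<And>i. i \<in> I \<Longrightarrow> p \<le> i" and r: "r \<in> I" "\<And>i. i \<in> I \<Longrightarrow> i \<le> r"
    using I(1) Ine by (auto simp: p_def r_def)
  have br: "a r < b r" using neg ne[OF r(1)] by (simp add: r_def)
  have out: "x j = z j" if "x \<in> layer k z I d" "j \<notin> I" for x j using that by (auto simp: layer_def)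
  have bound: "x j \<le> k" if "x \<in> layer k z I d" "j \<in> I" for x j using that by (auto simp: layer_def)
  have sums: "sum a I = d" "sum b I = d" using a b by (auto simp: layer_def)
  have below: "x j = y j" if "x \<in> layer k z I d" "y \<in> layer k z I d" "j < p" for x y j
    using that out p(2) by (metis not_less)
  have less_p: "lexless x y" if "x \<in> layer k z I d" "y \<in> layer k z I d" "x p < y p" for x y
    using that below by (intro lexlessI[of p]) auto
  have bp: "b p < a p"
  proof -
    obtain m where m: "\<forall>j<m. a j = b j" "b m < a m" using less by (auto simp: lexless_def)
    then have "m \<in> I" using out[OF a] out[OF b] by force
    then have "m = p" using m p ne[OF p(1)] by (metis le_neq_implies_less)
    then show ?thesis using m by simp
  qed
  then have pr: "p \<noteq> r" using br by auto
  have "card {p, r} < card I" using I pr by simp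
  then have "\<not> I \<subseteq> {p, r}" using card_mono[of "{p, r}" I] by auto
  then obtain s where s: "s \<in> I" "s \<noteq> p" "s \<noteq> r" by blast
  show False
  proof (cases "\<exists>s\<in>I - {p, r}. b s < a s")
    case True
    then obtain s where s: "s \<in> I" "s \<noteq> p" "s \<noteq> r" "b s < a s" by blast
    have sr: "s < r" using s r(2) by (simp add: le_neq_implies_less)
    show False
    proof (cases "a s - b s \<le> b r")
      case True
      \<comment> \<open>Raise \<open>b\<close> at \<open>s\<close> to \<open>a s\<close>, paying
        from the last coordinate. The result shares \<open>s\<close> with \<open>a\<close> and
        \<open>p\<close> with \<open>b\<close>.\<close>
      define c where "c = b(s := a s, r := b r - (a s - b s))"
      have "sum c I = d"
        using sum_upd2[OF I(1) s(1) r(1) s(3), of b "a s" "b r - (a s - b s)"] True s(4) sums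
        by (simp add: c_def)
      moreover have "c j \<le> k" if "j \<in> I" for j
        using bound[OF a that] bound[OF b that] s(4) by (auto simp: c_def)
      moreover have "c j = z j" if "j \<notin> I" for j
        using out[OF b that] that s(1) r(1) by (auto simp: c_def)
      ultimately have c: "c \<in> layer k z I d" by (simp add: layer_def)
      have "lexless b c" by (rule lexlessI[of s]) (use s sr in \<open>auto simp: c_def\<close>)
      moreover have "lexless c a" using bp s pr by (intro less_p c a) (simp add: c_def)
      ultimately show False
        using no[OF c _ _ s(1) p(1)] s pr by (simp add: c_def)
    next
      case False
      \<comment> \<open>Coordinate \<open>r\<close> of \<open>b\<close> cannot pay, so
        \<open>a\<close> is lowered instead: \<open>r\<close> rises to \<open>b r\<close> and
        \<open>s\<close> pays. As \<open>a s - b s > b r\<close>, the subtraction is not truncated.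
        The result shares \<open>p\<close> with \<open>a\<close> and \<open>r\<close> with
        \<open>b\<close>.\<close>
      define c where "c = a(s := a s - (b r - a r), r := b r)"
      have "sum c I = d"
        using sum_upd2[OF I(1) s(1) r(1) s(3), of a "a s - (b r - a r)" "b r"] False br sums
        by (simp add: c_def)
      moreover have "c j \<le> k" if "j \<in> I" for j
        using bound[OF a that] bound[OF b that] by (auto simp: c_def)
      moreover have "c j = z j" if "j \<notin> I" for j
        using out[OF a that] that s(1) r(1) by (auto simp: c_def)
      ultimately have c: "c \<in> layer k z I d" by (simp add: layer_def)
      have "lexless c a" by (rule lexlessI[of s]) (use s sr br False in \<open>auto simp: c_def\<close>)
      moreover have "lexless b c" using bp s pr by (intro less_p c b) (simp add: c_def)
      ultimately show False
        using no[OF c _ _ p(1) r(1)] s pr by (simp add: c_def)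
    qed
  next
    case False
    then have mid: "a i < b i" if "i \<in> I - {p, r}" for i
      using that ne[of i] by (metis DiffD1 linorder_neqE_nat)
    \<comment> \<open>Now \<open>a\<close> is below \<open>b\<close> in every coordinate but
      \<open>p\<close>. Moving only the excess at \<open>s\<close> to \<open>p\<close> keeps
      \<open>c p < a p\<close>, since the excess at \<open>r\<close> is positive and stays. The
      result shares \<open>s\<close> with \<open>a\<close> and \<open>r\<close> with
      \<open>b\<close>.\<close>
    define c where "c = b(p := b p + (b s - a s), s := a s)"
    have as: "a s < b s" using mid s by simp
    have "sum c I = d"
      using sum_upd2[OF I(1) p(1) s(1) s(2)[symmetric], of b "b p + (b s - a s)" "a s"] as sums
      by (simp add: c_def)
    moreover have cp: "c p < a p"
    proof -
      have split: "sum x I = x p + x s + x r + sum x (I - {p} - {s} - {r})" for x :: "nat \<Rightarrow> nat"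
        using I(1) p r s pr by (simp add: sum.remove[of I p] sum.remove[of "I - {p}" s]
            sum.remove[of "I - {p} - {s}" r])
      have "sum a (I - {p} - {s} - {r}) \<le> sum b (I - {p} - {s} - {r})"
        by (rule sum_mono) (use mid in \<open>auto intro: less_imp_le\<close>)
      then show ?thesis using split[of a] split[of b] sums as br s by (simp add: c_def)
    qed
    moreover have "c j \<le> k" if "j \<in> I" for j
      using bound[OF a that] bound[OF b that] cp by (cases "j = p") (auto simp: c_def)
    moreover have "c j = z j" if "j \<notin> I" for j
      using out[OF b that] that s(1) p(1) by (auto simp: c_def)
    ultimately have c: "c \<in> layer k z I d" by (simp add: layer_def)
    have "lexless c a" by (rule less_p[OF c a cp])
    moreover have "lexless b c" using as s by (intro less_p c b) (simp add: c_def)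
    ultimately show False
      using no[OF c _ _ s(1) r(1)] s pr by (simp add: c_def)
  qed
qed

text \<open>Removing the least point \<open>b\<close> of \<open>S\<close> loses
  \<open>inc r b\<close>, while adding the largest gap \<open>a\<close> contributes at most
  \<open>inc r a\<close> as a new shadow point.\<close>

lemma card_upper_exchange:
  assumes I: "finite I" "r \<in> I" "\<And>i. i \<in> I \<Longrightarrow> i \<le> r" and S: "S \<subseteq> layer k z I d"
    and b: "b \<in> S" "\<And>y. y \<in> S \<Longrightarrow> y \<noteq> b \<Longrightarrow> lexless b y"
    and a: "a \<in> layer k z I d - S" "\<And>y. y \<in> layer k z I d - S \<Longrightarrow> y \<noteq> a \<Longrightarrow> lexless y a"
    and less: "lexless b a" and r: "b r < a r"
  shows "card (upper k I (insert a (S - {b}))) \<le> card (upper k I S)"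
proof -
  have fin: "finite (upper k I S)" by (rule finite_upper[OF I(1) S])
  have ak: "a r \<le> k" using a(1) I(2) by (auto simp: layer_def)
  have bU: "inc r b \<in> upper k I S" using b(1) I(2) r ak by (intro upperI) auto
  \<comment> \<open>Another source of \<open>inc r b\<close> would have been raised at some
    \<open>j < r\<close>. It would then lie below \<open>b\<close>, whereas all points of the new
    set lie above \<open>b\<close>.\<close>
  have lost: "inc r b \<notin> upper k I (insert a (S - {b}))"
  proof
    assume "inc r b \<in> upper k I (insert a (S - {b}))"
    then obtain j x where x: "x \<in> insert a (S - {b})" "j \<in> I" "inc r b = inc j x"
      by (auto simp: upper_def)
    have "x \<noteq> b" using x(1) less lexless_irrefl by auto
    then have "j \<noteq> r" using x(3) injD[OF inj_inc] by metis
    then have jr: "j < r" using I(3)[OF x(2)] by simp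
    have eq: "inc r b i = inc j x i" for i using x(3) by simp
    have "lexless x b"
    proof (rule lexlessI[of j])
      show "b i = x i" if "i < j" for i using eq[of i] that jr by (simp add: inc_apply)
      show "x j < b j" using eq[of j] jr by (simp add: inc_apply)
    qed
    moreover have "lexless b x" using x(1) less b(2)[of x] by auto
    ultimately show False using lexless_asym by blast
  qed
  have "upper k I (insert a (S - {b})) \<subseteq> insert (inc r a) (upper k I S - {inc r b})"
  proof
    fix y assume y: "y \<in> upper k I (insert a (S - {b}))"
    then have yb: "y \<noteq> inc r b" using lost by blast
    obtain j x where x: "x \<in> insert a (S - {b})" "j \<in> I" "x j < k" "y = inc j x"
      using y by (auto simp: upper_def)
    have "y = inc r a \<or> y \<in> upper k I S"
    proof (cases "x = a \<and> j \<noteq> r")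
      case True
      then have jr: "j < r" using I(3)[OF x(2)] by simp
      \<comment> \<open>Raising \<open>a\<close> at \<open>j < r\<close> gives nothing new: lowering
        the result at \<open>r\<close>, possible because \<open>a r > b r\<close>, yields a point
        above \<open>a\<close>. That point is in \<open>S\<close> because \<open>a\<close> is the
        largest gap.\<close>
      define x' where "x' = y(r := y r - 1)"
      have yr: "y r = a r" using True by (simp add: x(4) inc_apply)
      have y': "y = inc r x'" using yr r by (auto simp: x'_def inc_def)
      have x'k: "x' r < k" using yr r ak by (simp add: x'_def)
      have "y \<in> layer k z I (Suc d)" using inc_layer_iff[of I j x k z d] I(1) x a(1) True by simp
      then have x'l: "x' \<in> layer k z I d" using inc_layer_iff[of I r x' k z d] I x'k y' by simp
      have "lexless a x'"
        by (rule lexlessI[of j]) (use jr True in \<open>auto simp: x'_def x(4) inc_apply\<close>)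
      then have "x' \<in> S" using a(2)[of x'] x'l lexless_asym lexless_irrefl by blast
      then show ?thesis unfolding y' using x'k I(2) upperI by blast
    qed (use x in \<open>auto intro: upperI\<close>)
    then show "y \<in> insert (inc r a) (upper k I S - {inc r b})" using yb by blast
  qed
  then have "card (upper k I (insert a (S - {b}))) \<le> card (insert (inc r a) (upper k I S - {inc r b}))"
    using fin by (intro card_mono) auto
  also have "\<dots> \<le> Suc (card (upper k I S - {inc r b}))" using fin by (simp add: card_insert_if)
  also have "\<dots> = card (upper k I S)" using fin bU by (rule card_Suc_Diff1)
  finally show ?thesis .
qed

lemma CL_step:
  assumes I: "finite I" "3 \<le> card I" and IH: "\<And>i. i \<in> I \<Longrightarrow> CL k (I - {i})"
  shows "CL k I"
  unfolding CL_def
proof (intro allI impI)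
  fix z d S0 A
  define P where "P = layer k z I d"
  define w where "w = (\<lambda>x. card {y \<in> P. lexless x y})"
  assume S0: "S0 \<subseteq> layer k z I d" and A: "seg (layer k z I d) A" and le: "card A \<le> card S0"
  have finP: "finite P" unfolding P_def using finite_layer I by blast
  have w: "w y < w x" if "x \<in> P" "y \<in> P" "lexless x y" for x y
    unfolding w_def using card_above_less[OF finP] that by blast
  let ?good = "\<lambda>S. S \<subseteq> P \<and> card S = card S0 \<and> card (upper k I S) \<le> card (upper k I S0)"
  obtain S where S: "S \<subseteq> P" "card S = card S0" "card (upper k I S) \<le> card (upper k I S0)"
    and min: "\<And>S'. ?good S' \<Longrightarrow> sum w S \<le> sum w S'"
    using ex_has_least_nat[of ?good S0 "sum w"] S0 P_def by auto
  have finS: "finite S" using S(1) finP finite_subset by blast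
  \<comment> \<open>Compression keeps the size and does not enlarge the shadow, so minimality of the
    weight forces it to fix \<open>S\<close>. Each slice of \<open>S\<close> is thus a
    segment.\<close>
  have compressed: "x \<in> S" if "y \<in> S" "x \<in> P" "i \<in> I" "x i = y i" "lexless y x" for x y i
  proof -
    let ?C = "compress i P S"
    have "card ?C = card S" "card (upper k I ?C) \<le> card (upper k I S)"
      using card_compress[OF I(1) that(3)] card_upper_compress[OF I(1) that(3) _ IH[OF that(3)]] S(1)
      unfolding P_def by auto
    then have "?good ?C" using compress_subset[of i P S] S by auto
    then have "sum w S \<le> sum w ?C" by (rule min)
    moreover have "sum w ?C < sum w S" if "?C \<noteq> S"
      unfolding P_def using that S(1) w
      by (intro sum_compress_less[OF I(1) \<open>i \<in> I\<close>]) (auto simp: P_def)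
    ultimately have "?C = S" by linarith
    then have "seg {u \<in> P. u i = y i} {u \<in> S. u i = y i}"
      using seg_slice_compress[OF finP, of i "y i" S] by simp
    then have "x \<in> {u \<in> S. u i = y i}" by (rule segD[of _ _ y]) (use that in auto)
    then show ?thesis by simp
  qed
  have "seg P S"
  proof (rule ccontr)
    assume "\<not> seg P S"
    then obtain x y where xy: "y \<in> S" "x \<in> P - S" "lexless y x" using S(1) by (auto simp: seg_def)
    obtain b where b: "b \<in> S" "\<And>y. y \<in> S \<Longrightarrow> y \<noteq> b \<Longrightarrow> lexless b y"
      using finite_lexless_min[OF finS] xy by blast
    obtain a where a: "a \<in> P - S" "\<And>y. y \<in> P - S \<Longrightarrow> y \<noteq> a \<Longrightarrow> lexless y a"
      using finite_lexless_max[of "P - S"] finP xy by blast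
    have less: "lexless b a"
      using xy a(2)[of x] b(2)[of y] lexless_trans by metis
    define r where "r = Max I"
    have r: "r \<in> I" "\<And>i. i \<in> I \<Longrightarrow> i \<le> r" unfolding r_def using I by (auto intro!: Max_in)
    have "b r < a r"
      unfolding r_def
    proof (rule last_coordinate_less[OF I, of a k z d b])
      show "a \<in> layer k z I d" "b \<in> layer k z I d" "lexless b a" using a b S(1) less P_def by auto
      show "a i \<noteq> b i" if "i \<in> I" for i using compressed[OF b(1) _ that _ less] a by auto
      fix c i j
      assume c: "c \<in> layer k z I d" "lexless b c" "lexless c a" "i \<in> I" "j \<in> I" "c i = a i" "c j = b j"
      \<comment> \<open>If \<open>c\<close> is in \<open>S\<close>, the slice through
        \<open>c\<close> and \<open>a\<close> forces \<open>a\<close> into \<open>S\<close>.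
        Otherwise the slice through \<open>b\<close> and \<open>c\<close> forces \<open>c\<close>
        into \<open>S\<close>.\<close>
      show False
      proof (cases "c \<in> S")
        case True
        then show False using compressed[OF True _ c(4) _ c(3)] a c(6) by auto
      next
        case False
        then show False using compressed[OF b(1) _ c(5) c(7) c(2)] c(1) by (auto simp: P_def)
      qed
    qed
    then have up: "card (upper k I (insert a (S - {b}))) \<le> card (upper k I S)"
      using card_upper_exchange[OF I(1) r, of S k z d b a] S(1) b a less unfolding P_def by blast
    have "card (insert a (S - {b})) = card S"
      using card_Suc_Diff1[OF finS b(1)] a(1) finS by simp
    then have "?good (insert a (S - {b}))" using S a up by auto
    then have "sum w S \<le> sum w (insert a (S - {b}))" by (rule min)
    moreover have "sum w (insert a (S - {b})) = w a + sum w (S - {b})" using finS a by simp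
    moreover have "sum w S = w b + sum w (S - {b})" using finS b by (simp add: sum.remove)
    moreover have "w a < w b" using w a b S(1) less by blast
    ultimately show False by simp
  qed
  then have "A \<subseteq> S" using seg_subset_if_card_le[of P A S] A le S finP by (simp add: P_def)
  then have "card (upper k I A) \<le> card (upper k I S)"
    using finite_upper[OF I(1)] S(1) by (intro card_mono upper_mono) (auto simp: P_def)
  then show "card (upper k I A) \<le> card (upper k I S0)" using S(3) by simp
qed

theorem clements_lindstroem:
  assumes "finite I"
  shows "CL k I"
  using assms
proof (induction "card I" arbitrary: I rule: less_induct)
  case less
  consider "card I \<le> 1" | "card I = 2" | "3 \<le> card I" by linarith
  then show ?case
  proof cases
    case 1
    then show ?thesis using CL_card_le_1 less.prems by blast
  next
    case 2
    then obtain p r where "I = {p, r}" "p \<noteq> r" by (auto simp: card_2_iff)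
    then show ?thesis using CL_pair[of p r] CL_pair[of r p] by (cases "p < r") (auto simp: insert_commute)
  next
    case 3
    show ?thesis
      by (rule CL_step[OF less.prems 3]) (use less in \<open>auto intro!: less.hyps psubset_card_mono\<close>)
  qed
qed

section \<open>Shadows of sets of mixed degree\<close>

definition box :: "nat \<Rightarrow> (nat \<Rightarrow> nat) \<Rightarrow> nat set \<Rightarrow> (nat \<Rightarrow> nat) set" where
  "box k z I = {x. (\<forall>j. j \<notin> I \<longrightarrow> x j = z j) \<and> (\<forall>j\<in>I. x j \<le> k)}"

text \<open>The counterpart of \<open>shadow\<close>, reaching all degrees at once, whereas
  \<open>upper\<close> is a single step. Divisibility becomes the pointwise order.\<close>

definition up :: "nat \<Rightarrow> (nat \<Rightarrow> nat) \<Rightarrow> nat set \<Rightarrow> (nat \<Rightarrow> nat) set \<Rightarrow> (nat \<Rightarrow> nat) set" where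
  "up k z I T = {x \<in> box k z I. \<exists>t\<in>T. t \<le> x}"

lemma layer_iff_box: "x \<in> layer k z I d \<longleftrightarrow> x \<in> box k z I \<and> sum x I = d"
  by (auto simp: layer_def box_def)

lemma sum_le_if_box: "x \<in> box k z I \<Longrightarrow> sum x I \<le> card I * k"
  using sum_bounded_above[of I x k] by (auto simp: box_def)

lemma finite_box:
  assumes "finite I"
  shows "finite (box k z I)"
proof -
  have "box k z I \<subseteq> (\<Union>e\<le>card I * k. layer k z I e)"
    using sum_le_if_box by (auto simp: layer_iff_box)
  then show ?thesis by (rule finite_subset) (use assms finite_layer in blast)
qed

lemma up_subset_box: "up k z I T \<subseteq> box k z I"
  by (auto simp: up_def)

lemma subset_up: "T \<subseteq> box k z I \<Longrightarrow> T \<subseteq> up k z I T"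
  by (auto simp: up_def)

lemma up_mono: "T \<subseteq> T' \<Longrightarrow> up k z I T \<subseteq> up k z I T'"
  by (auto simp: up_def)

lemma up_Un: "up k z I (T \<union> T') = up k z I T \<union> up k z I T'"
  by (auto simp: up_def)

lemma up_idem_subset: "T' \<subseteq> up k z I T \<Longrightarrow> up k z I T' \<subseteq> up k z I T"
  unfolding up_def using order_trans by blast

lemma fun_less_witness:
  fixes t x :: "nat \<Rightarrow> nat"
  assumes "t \<le> x" "t \<noteq> x"
  shows "\<exists>j. t j < x j"
proof (rule ccontr)
  assume "\<not> ?thesis"
  then have "x \<le> t" by (auto simp: le_fun_def not_less)
  then show False using assms by simp
qed

text \<open>No generator has degree \<open>Suc e\<close>, so a shadow point of that degree strictly
  exceeds its generator in some coordinate and can be lowered there within the shadow.\<close>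

lemma up_layer_Suc:
  assumes I: "finite I" and T: "T \<subseteq> box k z I" "\<And>t. t \<in> T \<Longrightarrow> sum t I \<le> e"
  shows "up k z I T \<inter> layer k z I (Suc e) = upper k I (up k z I T \<inter> layer k z I e)"
proof (intro equalityI subsetI)
  fix y assume y: "y \<in> up k z I T \<inter> layer k z I (Suc e)"
  then obtain t where t: "t \<in> T" "t \<le> y" by (auto simp: up_def)
  then have "t \<noteq> y" using T(2)[of t] y by (auto simp: layer_def)
  then obtain j where j: "t j < y j" using t(2) fun_less_witness by blast
  have jI: "j \<in> I" using j t T(1) y by (force simp: box_def layer_def)
  define x where "x = y(j := y j - 1)"
  have yx: "y = inc j x" using j by (auto simp: x_def inc_def)
  have xk: "x j < k" using j jI y by (auto simp: x_def layer_def)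
  have xl: "x \<in> layer k z I e" using inc_layer_iff[of I j x k z e] I jI xk y yx by simp
  have "t \<le> x" using t(2) j by (auto simp: le_fun_def x_def)
  then have "x \<in> up k z I T" using t xl by (auto simp: up_def layer_iff_box)
  then show "y \<in> upper k I (up k z I T \<inter> layer k z I e)" unfolding yx using xl jI xk by (intro upperI) auto
next
  fix y assume "y \<in> upper k I (up k z I T \<inter> layer k z I e)"
  then obtain i x where x: "x \<in> up k z I T" "x \<in> layer k z I e" "i \<in> I" "x i < k" "y = inc i x"
    by (auto simp: upper_def)
  then have y: "y \<in> layer k z I (Suc e)" using inc_layer_iff I by blast
  obtain t where t: "t \<in> T" "t \<le> x" using x by (auto simp: up_def)
  have "x \<le> y" by (auto simp: le_fun_def x(5) inc_apply)
  then show "y \<in> up k z I T \<inter> layer k z I (Suc e)" using y t order_trans by (auto simp: up_def layer_iff_box)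
qed

text \<open>Above degree \<open>d\<close> no new generators enter, so each layer is the one-step
  shadow of the previous one. \<open>seg_upper\<close> keeps the segment property alive, and
  Clements--Lindstroem keeps the inequality.\<close>

lemma card_up_layer_le:
  assumes I: "finite I"
    and T: "T \<subseteq> box k z I" "\<And>t. t \<in> T \<Longrightarrow> sum t I \<le> d"
    and U: "U \<subseteq> box k z I" "\<And>t. t \<in> U \<Longrightarrow> sum t I \<le> d"
    and seg: "seg (layer k z I d) (up k z I U \<inter> layer k z I d)"
    and card: "card (up k z I U \<inter> layer k z I d) \<le> card (up k z I T \<inter> layer k z I d)"
    and "d \<le> e"
  shows "seg (layer k z I e) (up k z I U \<inter> layer k z I e) \<and>
    card (up k z I U \<inter> layer k z I e) \<le> card (up k z I T \<inter> layer k z I e)"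
  using \<open>d \<le> e\<close>
proof (induction e rule: dec_induct)
  case base
  then show ?case using seg card by simp
next
  case (step e)
  have "sum t I \<le> e" if "t \<in> T \<or> t \<in> U" for t using T(2) U(2) that step.hyps le_trans by blast
  then have "up k z I T \<inter> layer k z I (Suc e) = upper k I (up k z I T \<inter> layer k z I e)"
    "up k z I U \<inter> layer k z I (Suc e) = upper k I (up k z I U \<inter> layer k z I e)"
    using up_layer_Suc[OF I T(1), of e] up_layer_Suc[OF I U(1), of e] by blast+
  then show ?case
    using step.IH seg_upper[OF I] CLD[OF clements_lindstroem[OF I], of "up k z I T \<inter> layer k z I e" k z e]
    by simp
qed

text \<open>Iterates \<open>lexless_predecessor\<close> from degree \<open>e'\<close> down to
  \<open>e\<close>, stopping if \<open>b\<close> itself is reached.\<close>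

lemma lexless_divisor:
  assumes I: "finite I" and b: "b \<in> layer k z I e" and "e \<le> e'"
    and "x \<in> layer k z I e'" "lexless b x"
  shows "\<exists>y\<in>layer k z I e. y \<le> x \<and> (y = b \<or> lexless b y)"
  using \<open>e \<le> e'\<close> assms(4,5)
proof (induction e' arbitrary: x rule: dec_induct)
  case base
  then show ?case by blast
next
  case (step n)
  obtain c j where c: "c \<in> layer k z I n" "x = inc j c" "c = b \<or> lexless b c"
    using lexless_predecessor[OF I step.prems(1) b step.hyps(1) step.prems(2)] by blast
  have cx: "c \<le> x" by (auto simp: c(2) inc_apply le_fun_def)
  show ?case
  proof (cases "c = b")
    case True
    then show ?thesis using b cx by blast
  next
    case False
    then show ?thesis using step.IH[OF c(1)] c(3) cx order_trans by blast
  qed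
qed

lemma seg_up_closed:
  assumes A: "seg P A" and x: "x \<in> up k z I A" "x \<in> P"
  shows "x \<in> A"
proof -
  obtain a where a: "a \<in> A" "a \<le> x" using x by (auto simp: up_def)
  then show ?thesis using segD[OF A a(1) x(2)] lexless_if_less by blast
qed

lemma seg_up_inter_layer:
  assumes A: "seg {x \<in> box k z I. sum x I \<le> d} A"
  shows "up k z I A \<inter> layer k z I d = A \<inter> layer k z I d"
proof
  show "up k z I A \<inter> layer k z I d \<subseteq> A \<inter> layer k z I d"
    using seg_up_closed[OF A] by (auto simp: layer_iff_box)
  show "A \<inter> layer k z I d \<subseteq> up k z I A \<inter> layer k z I d" by (auto simp: up_def layer_iff_box)
qed

lemma seg_up_layer_Suc:
  assumes I: "finite I" and A: "seg {x \<in> box k z I. sum x I \<le> d} A"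
  shows "seg (layer k z I (Suc d)) (up k z I A \<inter> layer k z I (Suc d))"
proof -
  have *: "up k z I A \<inter> layer k z I (Suc d) = upper k I (up k z I A \<inter> layer k z I d)"
    by (rule up_layer_Suc[OF I]) (use seg_subset[OF A] in auto)
  have "up k z I A \<inter> layer k z I d = A \<inter> layer k z I d" by (rule seg_up_inter_layer[OF A])
  moreover have "seg (layer k z I d) (A \<inter> layer k z I d)"
    using A by (auto simp: seg_def layer_iff_box)
  ultimately show ?thesis using seg_upper[OF I] * by simp
qed

text \<open>Close \<open>T\<close> upwards inside degree \<open>\<le> d\<close>. If its part of degree \<open>d\<close> were smaller than that of
  \<open>A\<close>, its part of some degree \<open>e < d\<close> would have to be larger than that of \<open>A\<close>. The lexicographic
  segment of that size contains some \<open>b \<notin> A\<close>, so its shadow covers all of \<open>A\<close> in degree \<open>d\<close>.\<close>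

lemma card_up_next_layer_le:
  assumes I: "finite I" and A: "seg {x \<in> box k z I. sum x I \<le> d} A"
    and T: "T \<subseteq> {x \<in> box k z I. sum x I \<le> d}" and card: "card A \<le> card T"
  shows "card (up k z I A \<inter> layer k z I (Suc d)) \<le> card (up k z I T \<inter> layer k z I (Suc d))"
proof -
  define V where "V = up k z I T \<inter> {x. sum x I \<le> d}"
  have Vbox: "V \<subseteq> box k z I" by (auto simp: V_def up_def)
  have finV: "finite V" using finite_subset[OF Vbox] finite_box[OF I] by blast
  have Abox: "A \<subseteq> box k z I" using seg_subset[OF A] by auto
  have finA: "finite A" using finite_subset[OF Abox] finite_box[OF I] by blast
  have "T \<subseteq> V" using subset_up[of T k z I] T by (auto simp: V_def)
  then have AV: "card A \<le> card V" using card_mono[OF finV] card le_trans by blast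
  have by_degree: "card X = (\<Sum>e\<le>d. card (X \<inter> layer k z I e))"
    if "finite X" "X \<subseteq> box k z I" "\<And>x. x \<in> X \<Longrightarrow> sum x I \<le> d" for X
  proof -
    have "(\<lambda>x. sum x I) ` X \<subseteq> {..d}" using that(3) by auto
    then have "card X = (\<Sum>e\<le>d. card {x \<in> X. sum x I = e})"
      using sum.group[of X "{..d}" "\<lambda>x. sum x I" "\<lambda>_. 1::nat"] that(1) by simp
    also have "\<dots> = (\<Sum>e\<le>d. card (X \<inter> layer k z I e))"
      using that(2) by (intro sum.cong arg_cong[where f = card]) (auto simp: layer_iff_box)
    finally show ?thesis .
  qed
  have seg_layer: "seg (layer k z I e) (A \<inter> layer k z I e)" if "e \<le> d" for e
    using A that by (auto simp: seg_def layer_iff_box)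
  have top: "card (A \<inter> layer k z I d) \<le> card (V \<inter> layer k z I d)"
  proof (rule ccontr)
    assume neg: "\<not> ?thesis"
    have "\<exists>e\<in>{..d}. card (A \<inter> layer k z I e) < card (V \<inter> layer k z I e)"
    proof (rule ccontr)
      assume "\<not> ?thesis"
      then have "(\<Sum>e\<le>d. card (V \<inter> layer k z I e)) < (\<Sum>e\<le>d. card (A \<inter> layer k z I e))"
        using neg by (intro sum_strict_mono_ex1 bexI[of _ d]) (auto simp: not_less)
      then show False
        using AV by_degree[OF finV Vbox] by_degree[OF finA Abox] seg_subset[OF A] by (auto simp: V_def)
    qed
    then obtain e where e: "e \<le> d" "card (A \<inter> layer k z I e) < card (V \<inter> layer k z I e)" by blast
    have finL: "finite (layer k z I e)" by (rule finite_layer[OF I])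
    define W where "W = first (layer k z I e) (card (V \<inter> layer k z I e))"
    have W: "seg (layer k z I e) W" "card W = card (V \<inter> layer k z I e)"
      unfolding W_def using seg_first[OF finL] card_first[OF finL] card_mono[OF finL] by auto
    have Wl: "W \<subseteq> layer k z I e" using seg_subset[OF W(1)] .
    have "\<not> W \<subseteq> A \<inter> layer k z I e"
      using e W(2) card_mono[of "A \<inter> layer k z I e" W] finL by auto
    then obtain b where b: "b \<in> W" "b \<notin> A" using Wl by blast
    have bl: "b \<in> layer k z I e" using b Wl by blast
    \<comment> \<open>Since \<open>b\<close> is missing from the segment \<open>A\<close>, all
      points of \<open>A\<close> lie above \<open>b\<close>. Such a point of degree \<open>d\<close>
      has a divisor of degree \<open>e\<close> that is \<open>b\<close> or above it, hence in
      \<open>W\<close>.\<close>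
    have "A \<inter> layer k z I d \<subseteq> up k z I W \<inter> layer k z I d"
    proof
      fix x assume x: "x \<in> A \<inter> layer k z I d"
      have "b \<in> {x \<in> box k z I. sum x I \<le> d}" using bl e(1) by (auto simp: layer_iff_box)
      then have "\<not> lexless x b" using segD[OF A, of x b] x b by blast
      moreover have "x \<noteq> b" using x b by blast
      ultimately have "lexless b x" using lexless_linear by blast
      then obtain y where y: "y \<in> layer k z I e" "y \<le> x" "y = b \<or> lexless b y"
        using lexless_divisor[OF I bl e(1)] x by blast
      then have "y \<in> W" using segD[OF W(1) b(1)] b by blast
      then show "x \<in> up k z I W \<inter> layer k z I d" using x y by (auto simp: up_def layer_iff_box)
    qed
    then have "card (A \<inter> layer k z I d) \<le> card (up k z I W \<inter> layer k z I d)"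
      using finite_layer[OF I] by (intro card_mono) auto
    also have "\<dots> \<le> card (up k z I (V \<inter> layer k z I e) \<inter> layer k z I d)"
    proof -
      \<comment> \<open>Within a single degree comparable points are equal, so the comparison can
        start at degree \<open>e\<close> from \<open>W\<close> and the part of \<open>V\<close>
        there.\<close>
      have same: "up k z I X \<inter> layer k z I e = X" if "X \<subseteq> layer k z I e" for X
      proof
        show "up k z I X \<inter> layer k z I e \<subseteq> X"
        proof
          fix x assume x: "x \<in> up k z I X \<inter> layer k z I e"
          then obtain t where t: "t \<in> X" "t \<le> x" by (auto simp: up_def)
          have "t = x"
          proof (rule ccontr)
            assume "t \<noteq> x"
            then obtain j where j: "t j < x j" using t(2) fun_less_witness by blast
            then have "j \<in> I" using t(1) that x by (force simp: layer_def)
            then have "sum t I < sum x I"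
              using j t(2) I by (intro sum_strict_mono_ex1) (auto simp: le_fun_def)
            then show False using t(1) that x by (auto simp: layer_def)
          qed
          then show "x \<in> X" using t by simp
        qed
        show "X \<subseteq> up k z I X \<inter> layer k z I e" using that by (auto simp: up_def layer_iff_box)
      qed
      have "seg (layer k z I d) (up k z I W \<inter> layer k z I d) \<and>
        card (up k z I W \<inter> layer k z I d) \<le> card (up k z I (V \<inter> layer k z I e) \<inter> layer k z I d)"
      proof (rule card_up_layer_le[OF I])
        show "V \<inter> layer k z I e \<subseteq> box k z I" "W \<subseteq> box k z I" using Vbox Wl by (auto simp: layer_iff_box)
        show "sum t I \<le> e" if "t \<in> V \<inter> layer k z I e" for t using that by (auto simp: layer_def)
        show "sum t I \<le> e" if "t \<in> W" for t using that Wl by (auto simp: layer_def)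
        show "seg (layer k z I e) (up k z I W \<inter> layer k z I e)" using W same[OF Wl] by simp
        show "card (up k z I W \<inter> layer k z I e) \<le> card (up k z I (V \<inter> layer k z I e) \<inter> layer k z I e)"
          using W same[OF Wl] same[of "V \<inter> layer k z I e"] by simp
      qed (rule e(1))
      then show ?thesis ..
    qed
    also have "\<dots> \<le> card (V \<inter> layer k z I d)"
    proof (rule card_mono)
      have "up k z I (V \<inter> layer k z I e) \<subseteq> up k z I T" by (rule up_idem_subset) (auto simp: V_def)
      then show "up k z I (V \<inter> layer k z I e) \<inter> layer k z I d \<subseteq> V \<inter> layer k z I d"
        by (auto simp: V_def layer_iff_box)
    qed (use finV in simp)
    finally show False using neg by simp
  qed
  have "up k z I A \<inter> layer k z I (Suc d) = upper k I (up k z I A \<inter> layer k z I d)"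
    by (rule up_layer_Suc[OF I Abox]) (use seg_subset[OF A] in auto)
  moreover have "up k z I T \<inter> layer k z I (Suc d) = upper k I (up k z I T \<inter> layer k z I d)"
    by (rule up_layer_Suc[OF I]) (use T in auto)
  moreover have "up k z I A \<inter> layer k z I d = A \<inter> layer k z I d" by (rule seg_up_inter_layer[OF A])
  moreover have "up k z I T \<inter> layer k z I d = V \<inter> layer k z I d"
    by (auto simp: V_def layer_iff_box)
  ultimately show ?thesis
    using CLD[OF clements_lindstroem[OF I] _ seg_layer[OF order_refl] top] by simp
qed

text \<open>The bound in terms of functions, with \<open>A\<close> for the \<open>L\<close> part and
  \<open>B\<close> for the \<open>M\<close> part. The top degree is written \<open>Suc d\<close>, so
  that \<open>d\<close> is the degree bound for \<open>B\<close>. The shadows are compared in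
  degrees up to \<open>d\<close>, in degree \<open>Suc d\<close>, and beyond.\<close>

lemma card_up_le:
  assumes I: "finite I" and T: "T \<subseteq> box k z I" "\<And>t. t \<in> T \<Longrightarrow> sum t I \<le> Suc d"
    and A: "seg (layer k z I (Suc d)) A" "card A = card (T \<inter> layer k z I (Suc d))"
    and B: "seg {x \<in> box k z I. sum x I \<le> d} B" "card B = card (T - layer k z I (Suc d))"
  shows "card (up k z I (A \<union> B)) \<le> card (up k z I T)"
proof -
  define U where "U = A \<union> B"
  define T2 where "T2 = T - layer k z I (Suc d)"
  define low where "low = {x :: nat \<Rightarrow> nat. sum x I \<le> d}"
  have T2: "T2 \<subseteq> {x \<in> box k z I. sum x I \<le> d}"
    using T by (fastforce simp: T2_def layer_iff_box)
  have Abox: "A \<subseteq> box k z I" and Adeg: "\<And>t. t \<in> A \<Longrightarrow> sum t I = Suc d"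
    using seg_subset[OF A(1)] by (auto simp: layer_iff_box)
  have Bbox: "B \<subseteq> box k z I" and Bdeg: "\<And>t. t \<in> B \<Longrightarrow> sum t I \<le> d"
    using seg_subset[OF B(1)] by auto
  have finup: "finite (up k z I X)" for X
    using finite_subset[OF up_subset_box finite_box[OF I]] .
  have mono: "sum t I \<le> sum x I" if "t \<le> x" for t x :: "nat \<Rightarrow> nat"
    using that by (intro sum_mono) (auto simp: le_fun_def)
  \<comment> \<open>\<open>A\<close> reaches no degree below its own, and \<open>B\<close> is upward
    closed within degrees at most \<open>d\<close>.\<close>
  have Ulow: "up k z I U \<inter> low = B"
  proof -
    have "up k z I A \<inter> low = {}"
    proof (rule ccontr)
      assume "\<not> ?thesis"
      then obtain t x where "t \<in> A" "t \<le> x" "sum x I \<le> d" by (auto simp: up_def low_def)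
      then show False using mono[of t x] Adeg[of t] by simp
    qed
    moreover have "up k z I B \<inter> low \<subseteq> B"
      using seg_up_closed[OF B(1), of _ k z I] up_subset_box[of k z I B] by (auto simp: low_def)
    moreover have "B \<subseteq> up k z I B \<inter> low" using subset_up[OF Bbox] Bdeg by (auto simp: low_def)
    ultimately show ?thesis unfolding U_def up_Un by blast
  qed
  have "T2 \<subseteq> up k z I T \<inter> low" using T2 subset_up[OF T(1)] by (auto simp: low_def T2_def)
  then have low: "card (up k z I U \<inter> low) \<le> card (up k z I T \<inter> low)"
    unfolding Ulow B(2) T2_def[symmetric] using finup by (intro card_mono) auto
  have UA: "up k z I A \<inter> layer k z I (Suc d) \<subseteq> A" using seg_up_closed[OF A(1)] by blast
  have Ulayer: "up k z I U \<inter> layer k z I (Suc d) = A \<union> (up k z I B \<inter> layer k z I (Suc d))"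
    using UA subset_up[OF Abox] seg_subset[OF A(1)] by (auto simp: U_def up_Un)
  have segB: "seg (layer k z I (Suc d)) (up k z I B \<inter> layer k z I (Suc d))"
    by (rule seg_up_layer_Suc[OF I B(1)])
  have "card (up k z I B \<inter> layer k z I (Suc d)) \<le> card (up k z I T2 \<inter> layer k z I (Suc d))"
    by (rule card_up_next_layer_le[OF I B(1) T2]) (simp add: B(2) T2_def)
  also have "\<dots> \<le> card (up k z I T \<inter> layer k z I (Suc d))"
    using finup up_mono[of T2 T k z I] by (intro card_mono) (auto simp: T2_def)
  finally have cardB: "card (up k z I B \<inter> layer k z I (Suc d)) \<le> card (up k z I T \<inter> layer k z I (Suc d))" .
  have cardA: "card A \<le> card (up k z I T \<inter> layer k z I (Suc d))"
    unfolding A(2) using finup subset_up[OF T(1)] by (intro card_mono) auto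
  have layers: "card (up k z I U \<inter> layer k z I e) \<le> card (up k z I T \<inter> layer k z I e)"
    if "Suc d \<le> e" for e
  proof -
    have "seg (layer k z I e) (up k z I U \<inter> layer k z I e) \<and>
      card (up k z I U \<inter> layer k z I e) \<le> card (up k z I T \<inter> layer k z I e)"
    proof (rule card_up_layer_le[OF I T _ _ _ _ that])
      show "U \<subseteq> box k z I" using Abox Bbox by (simp add: U_def)
      show "sum t I \<le> Suc d" if "t \<in> U" for t using that Adeg[of t] Bdeg[of t] by (auto simp: U_def)
      show "seg (layer k z I (Suc d)) (up k z I U \<inter> layer k z I (Suc d))"
        unfolding Ulayer by (rule seg_Un[OF A(1) segB])
      show "card (up k z I U \<inter> layer k z I (Suc d)) \<le> card (up k z I T \<inter> layer k z I (Suc d))"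
        unfolding Ulayer using card_Un_seg[OF A(1) segB] cardA cardB by auto
    qed
    then show ?thesis ..
  qed
  have split: "card (up k z I X) = card (up k z I X \<inter> low)
      + (\<Sum>e\<in>{Suc d..card I * k}. card (up k z I X \<inter> layer k z I e))" for X
  proof -
    have "(\<Sum>e\<in>{Suc d..card I * k}. card {x \<in> up k z I X - low. sum x I = e}) = card (up k z I X - low)"
      using sum.group[of "up k z I X - low" "{Suc d..card I * k}" "\<lambda>x. sum x I" "\<lambda>_. 1::nat"]
        finup sum_le_if_box up_subset_box[of k z I X] by (fastforce simp: low_def)
    moreover have "{x \<in> up k z I X - low. sum x I = e} = up k z I X \<inter> layer k z I e"
      if "e \<in> {Suc d..card I * k}" for e
      using that by (auto simp: low_def layer_iff_box up_def)
    ultimately have "(\<Sum>e\<in>{Suc d..card I * k}. card (up k z I X \<inter> layer k z I e)) = card (up k z I X - low)"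
      by simp
    then show ?thesis using card_Int_Diff[OF finup, of X low] by simp
  qed
  show ?thesis
    unfolding U_def[symmetric] split[of U] split[of T]
    by (intro add_mono low sum_mono layers) auto
qed

section \<open>Exponent lists as functions\<close>

text \<open>Padding by 0 places the image in a box whose frozen coordinates are 0. It forgets the
  length, so injectivity is claimed only on \<open>H q l\<close>.\<close>

definition exps :: "nat list \<Rightarrow> nat \<Rightarrow> nat" where
  "exps a i = (if i < length a then a ! i else 0)"

lemma inj_on_exps: "inj_on exps (H q l)"
proof (rule inj_onI)
  fix a b assume ab: "a \<in> H q l" "b \<in> H q l" "exps a = exps b"
  have "a ! i = b ! i" if "i < l" for i
    using fun_cong[OF ab(3), of i] ab(1,2) that by (simp add: exps_def H_def)
  then show "a = b" using ab(1,2) by (intro nth_equalityI) (auto simp: H_def)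
qed

lemma exps_image_H: "exps ` H q l = box (q - 1) (\<lambda>_. 0) {..<l}"
proof (intro equalityI subsetI)
  fix x assume x: "x \<in> box (q - 1) (\<lambda>_. 0) {..<l}"
  have "x = exps (map x [0..<l])" using x by (intro ext) (auto simp: exps_def box_def)
  moreover have "map x [0..<l] \<in> H q l" using x by (auto simp: H_def box_def)
  ultimately show "x \<in> exps ` H q l" by blast
qed (auto simp: H_def box_def exps_def)

lemma sum_exps: "a \<in> H q l \<Longrightarrow> sum (exps a) {..<l} = sum_list a"
  by (auto simp: H_def exps_def sum_list_sum_nth atLeast0LessThan)

lemma exps_image_Hd: "exps ` Hd q l d = layer (q - 1) (\<lambda>_. 0) {..<l} d"
  unfolding Hd_def set_eq_iff layer_iff_box exps_image_H[symmetric] by (auto simp: sum_exps)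

lemma exps_image_Hle: "exps ` Hle q l d = {x \<in> box (q - 1) (\<lambda>_. 0) {..<l}. sum x {..<l} \<le> d}"
  unfolding Hle_def exps_image_H[symmetric] by (auto simp: sum_exps)

lemma mdvd_iff_exps:
  assumes "a \<in> H q l" "b \<in> H q l"
  shows "mdvd a b \<longleftrightarrow> exps a \<le> exps b"
  using assms by (auto simp: mdvd_def le_fun_def exps_def H_def)

lemma lex_prec_iff_exps:
  assumes "a \<in> H q l" "b \<in> H q l"
  shows "lex_prec a b \<longleftrightarrow> lexless (exps a) (exps b)"
proof
  assume "lex_prec a b"
  then obtain i where "i < length b" "\<forall>j<i. b ! j = a ! j" "a ! i < b ! i"
    by (auto simp: lex_prec_def)
  then show "lexless (exps a) (exps b)"
    using assms by (intro lexlessI[of i]) (auto simp: exps_def H_def)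
next
  assume "lexless (exps a) (exps b)"
  then obtain i where i: "\<forall>j<i. exps b j = exps a j" "exps a i < exps b i"
    by (auto simp: lexless_def)
  then have "i < l" using assms by (auto simp: exps_def H_def split: if_splits)
  moreover have "\<forall>j<i. b ! j = a ! j"
  proof (intro allI impI)
    fix j assume "j < i"
    then have "exps b j = exps a j" "j < l" using i(1) \<open>i < l\<close> by auto
    then show "b ! j = a ! j" using assms by (simp add: exps_def H_def)
  qed
  moreover have "a ! i < b ! i" using i(2) \<open>i < l\<close> assms by (simp add: exps_def H_def)
  ultimately show "lex_prec a b" using assms by (auto simp: lex_prec_def H_def)
qed

text \<open>\<open>exps\<close> is injective and preserves the order on \<open>H q l\<close>, so
  every element keeps its number of elements above it.\<close>

lemma exps_image_first_lex:
  assumes "S \<subseteq> H q l"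
  shows "exps ` first_lex S r = first (exps ` S) r"
proof -
  have "card {b \<in> S. lex_prec a b} = card {y \<in> exps ` S. lexless (exps a) y}" if "a \<in> S" for a
  proof -
    have "{y \<in> exps ` S. lexless (exps a) y} = exps ` {b \<in> S. lex_prec a b}"
      using assms that lex_prec_iff_exps by blast
    moreover have "inj_on exps {b \<in> S. lex_prec a b}"
      by (rule inj_on_subset[OF inj_on_exps]) (use assms in blast)
    ultimately show ?thesis by (simp add: card_image)
  qed
  then show ?thesis by (auto simp: first_lex_def first_def)
qed

lemma exps_image_shadow:
  assumes "T \<subseteq> H q l"
  shows "exps ` shadow q l T = up (q - 1) (\<lambda>_. 0) {..<l} (exps ` T)"
proof (intro equalityI subsetI)
  fix x assume "x \<in> exps ` shadow q l T"
  then obtain a b where "a \<in> H q l" "b \<in> T" "mdvd b a" "x = exps a" by (auto simp: shadow_def)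
  then show "x \<in> up (q - 1) (\<lambda>_. 0) {..<l} (exps ` T)"
    unfolding up_def exps_image_H[symmetric] using assms mdvd_iff_exps[of b q l a] by blast
next
  fix x assume "x \<in> up (q - 1) (\<lambda>_. 0) {..<l} (exps ` T)"
  then obtain a b where "a \<in> H q l" "b \<in> T" "exps b \<le> exps a" "x = exps a"
    unfolding up_def exps_image_H[symmetric] by blast
  then show "x \<in> exps ` shadow q l T"
    using assms mdvd_iff_exps[of b q l a] by (auto simp: shadow_def)
qed

lemma finite_H: "finite (H q l)"
  using finite_imageD[OF _ inj_on_exps, of q l] finite_box[of "{..<l}"] by (simp add: exps_image_H)

lemma card_footprint:
  assumes "T \<subseteq> H q l"
  shows "card (footprint q l T) = card (H q l) - card (up (q - 1) (\<lambda>_. 0) {..<l} (exps ` T))"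
proof -
  have sub: "shadow q l T \<subseteq> H q l" by (auto simp: shadow_def)
  then have "card (exps ` shadow q l T) = card (shadow q l T)"
    by (intro card_image inj_on_subset[OF inj_on_exps])
  then show ?thesis
    unfolding footprint_def exps_image_shadow[OF assms]
    using card_Diff_subset[OF finite_subset[OF sub finite_H] sub] by simp
qed

section \<open>Transfer of the shadow bound to footprints of monomials\<close>

theorem theorem3p7:
  fixes q m l d \<rho> :: nat and T :: "nat list set"
  assumes q: "\<exists>p k. prime p \<and> k > 0 \<and> q = p ^ k"
    and m: "m > 0"
    and l: "0 < l" "l \<le> m"
    and d: "0 < d" "d \<le> l * (q - 1)"
    and \<rho>: "0 < \<rho>" "\<rho> \<le> card (Hle q l d)"
    and T: "T \<subseteq> Hle q l d" "card T = \<rho>"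
  shows "card (footprint q l T)
           \<le> card (footprint q l (L q l d (card (T \<inter> Hd q l d))
                 \<union> M q l (d - 1) (\<rho> - card (T \<inter> Hd q l d))))"
proof -
  define k z I where "k = q - 1" and "z = (\<lambda>_::nat. 0::nat)" and "I = {..<l}"
  obtain e where e: "d = Suc e" using d(1) by (cases d) auto
  have I: "finite I" by (simp add: I_def)
  define T1 T2 where "T1 = T \<inter> Hd q l d" and "T2 = T - Hd q l d"
  have TH: "T \<subseteq> H q l" and HdH: "Hd q l d \<subseteq> H q l" and HleH: "Hle q l e \<subseteq> H q l"
    using T(1) by (auto simp: Hd_def Hle_def)
  have fin: "finite (Hd q l d)" "finite (Hle q l e)" "finite T"
    using finite_subset[OF _ finite_H] HdH HleH TH by blast+
  have T2_sub: "T2 \<subseteq> Hle q l e" using T(1) by (fastforce simp: T2_def Hd_def Hle_def e)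
  have T1_sub: "T1 \<subseteq> H q l" using TH by (auto simp: T1_def)
  have T2_card: "\<rho> - card T1 = card T2"
    using card_Int_Diff[OF fin(3), of "Hd q l d"] T(2) by (simp add: T1_def T2_def)
  define A B where "A = L q l d (card T1)" and "B = M q l e (card T2)"
  have AB: "A \<subseteq> H q l" "B \<subseteq> H q l"
    using HdH HleH by (auto simp: A_def B_def L_def M_def first_lex_def)
  have Hd_eq: "exps ` Hd q l d = layer k z I d"
    unfolding k_def z_def I_def by (rule exps_image_Hd)
  have Hle_eq: "exps ` Hle q l e = {x \<in> box k z I. sum x I \<le> e}"
    unfolding k_def z_def I_def by (rule exps_image_Hle)
  have card_exps: "card (exps ` X) = card X" if "X \<subseteq> H q l" for X
    by (rule card_image[OF inj_on_subset[OF inj_on_exps that]])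
  have A: "exps ` A = first (layer k z I d) (card T1)"
    unfolding A_def L_def exps_image_first_lex[OF HdH] Hd_eq ..
  have B: "exps ` B = first {x \<in> box k z I. sum x I \<le> e} (card T2)"
    unfolding B_def M_def exps_image_first_lex[OF HleH] Hle_eq ..
  have T1_image: "exps ` T \<inter> layer k z I d = exps ` T1"
    unfolding Hd_eq[symmetric] T1_def by (rule inj_on_image_Int[OF inj_on_exps TH HdH, symmetric])
  have T2_image: "exps ` T - layer k z I d = exps ` T2"
    unfolding Hd_eq[symmetric] T2_def
    by (rule inj_on_image_set_diff[OF inj_on_exps _ HdH, symmetric]) (use TH in blast)
  have Tbox: "exps ` T \<subseteq> box k z I"
    unfolding k_def z_def I_def exps_image_H[symmetric] using TH by blast
  have Tdeg: "sum t I \<le> d" if "t \<in> exps ` T" for t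
    using that T(1) exps_image_Hle[of q l d] by (auto simp: I_def)
  have A_seg: "seg (layer k z I d) (exps ` A)"
    unfolding A by (rule seg_first[OF finite_layer[OF I]])
  \<comment> \<open>The requested size must not exceed that of the layer for
    \<open>card_first\<close> to apply; \<open>T1\<close> itself lies in that layer. The same
    reasoning with \<open>T2\<close> serves \<open>B\<close>.\<close>
  have A_card: "card (exps ` A) = card (exps ` T \<inter> layer k z I d)"
  proof -
    have "card T1 \<le> card (layer k z I d)"
      unfolding Hd_eq[symmetric] card_exps[OF HdH] by (rule card_mono[OF fin(1)]) (simp add: T1_def)
    then show ?thesis
      unfolding A T1_image card_exps[OF T1_sub] by (rule card_first[OF finite_layer[OF I]])
  qed
  have finle: "finite {x \<in> box k z I. sum x I \<le> e}" using finite_box[OF I] by simp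
  have B_seg: "seg {x \<in> box k z I. sum x I \<le> e} (exps ` B)"
    unfolding B by (rule seg_first[OF finle])
  have B_card: "card (exps ` B) = card (exps ` T - layer k z I d)"
  proof -
    have "card T2 \<le> card {x \<in> box k z I. sum x I \<le> e}"
      unfolding Hle_eq[symmetric] card_exps[OF HleH] by (rule card_mono[OF fin(2) T2_sub])
    then show ?thesis
      unfolding B T2_image card_exps[OF order_trans[OF T2_sub HleH]] by (rule card_first[OF finle])
  qed
  have "card (up k z I (exps ` A \<union> exps ` B)) \<le> card (up k z I (exps ` T))"
    by (rule card_up_le[OF I Tbox Tdeg[unfolded e] A_seg[unfolded e] A_card[unfolded e] B_seg B_card[unfolded e]])
  \<comment> \<open>Footprints are complements of shadows in \<open>H q l\<close>, so the inequality
    reverses.\<close>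
  then have "card (footprint q l T) \<le> card (footprint q l (A \<union> B))"
    using card_footprint[OF TH] card_footprint[of "A \<union> B" q l] AB
    by (simp add: image_Un k_def z_def I_def diff_le_mono2)
  moreover have "d - 1 = e" using e by simp
  ultimately show ?thesis
    using T2_card by (simp add: A_def B_def T1_def)
qed

end
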